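(* Let $\Omega=\Omega_1\times\dots\times\Omega_K$ with each $\Omega_k\subseteq\mathbb{R}^{n_k}$ a non-empty polyhedron, let $x^0\in\Omega$, and let $\{x^l\}$ be the sequence generated from $x^0$ by the trust region algorithm with alternating projections (TRAP) described in the context. Assume that (i) $L$ is bounded below on $\{x\in\Omega: L(x)\le L(x^0)\}$; (ii) $L$ is continuously differentiable in an open set containing $\Omega$ and its gradient $\nabla L$ is uniformly continuous; (iii) there exists $\hat B>0$ such that $\|B(x)\|_2\le\hat B$ for all $x\in\Omega$; (iv) $\{x^l\}$ has a non-degenerate limit point $x^{\ast}$ such that, for some $\kappa>0$, $\langle v,H(x^{\ast})v\rangle\ge\kappa\|v\|_2^2$ for all $v\in\mathcal{N}_\Omega(x^{\ast})^\perp:=\{v\in\mathbb{R}^n:\langle w,v\rangle=0\ \ \forall w\in\mathcal{N}_\Omega(x^{\ast})\}$, where $H=\nabla^2L$ denotes the Hessian of $L$. Then $$\lim_{l\to+\infty}\|\nabla_\Omega L(x^l)\|_2=0 .$$ Moreover, there exists $l_0$ such that for all $l\ge l_0$, $\mathcal{A}_\Omega(x^l)=\mathcal{A}_\Omega(x^{\ast})$.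
   Context: Notation. $x=(x_1^\top,\dots,x_K^\top)^\top\in\mathbb{R}^n$ with $x_k\in\mathbb{R}^{n_k}$, $n=\sum_k n_k$. $\Omega_k=\{x_k\in\mathbb{R}^{n_k}:\langle\omega_{k,i},x_k\rangle\le h_{k,i},\ i=1,\dots,m_k\}$. $P_S$ is the Euclidean projection onto the closed convex set $S$. $\mathcal{A}_{\Omega_k}(x_k)$ is the set of indices $i$ with $\langle\omega_{k,i},x_k\rangle=h_{k,i}$, and $\mathcal{A}_\Omega(x)=\{(k,i): i\in\mathcal{A}_{\Omega_k}(x_k)\}$ is the set of active constraints at $x$. $\mathcal{N}_\Omega(x)=\{v:\langle v,y-x\rangle\le0\ \forall y\in\Omega\}$ and $\mathcal{T}_\Omega(x)$ are the normal and tangent cones to $\Omega$ at $x$. $g(x)=\nabla L(x)$. The projected gradient is $\nabla_\Omega L(x):=P_{\mathcal{T}_\Omega(x)}(-g(x))$. A point $x\in\Omega$ is critical for $L+\iota_\Omega$ ($\iota_\Omega$ the indicator function of $\Omega$) iff $\nabla_\Omega L(x)=0$; it is non-degenerate if $-g(x)\in\operatorname{ri}(\mathcal{N}_\Omega(x))$ (relative interior). Model. At an iterate $x\in\Omega$, with $B(x)\in\mathbb{R}^{n\times n}$ symmetric, $$m(x'):=L(x)+\langle g(x),x'-x\rangle+\tfrac12\langle x'-x,B(x)(x'-x)\rangle .$$ TRAP. Fixed parameters: initial radius $\Delta^0>0$; $0<\sigma_1<\sigma_2<1<\sigma_3$; $0<\eta_1<\eta_2<1$; $\gamma_1\in(0,1)$,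 $\gamma_2>0$; $\nu_0\in(0,1)$, $0<\nu_1<\nu_2$, $\nu_3,\nu_4,\nu_5>0$; $0<\underline\sigma<\bar\sigma$. One iteration from $x=x^l\in\Omega$ with radius $\Delta=\Delta^l>0$: (1) Cauchy point. For $k=1,\dots,K$ in order, let $m_k(u):=m(z_1,\dots,z_{k-1},u,x_{k+1},\dots,x_K)$ for $u\in\mathbb{R}^{n_k}$, $z_k(\alpha):=P_{\Omega_k}(x_k-\alpha\nabla m_k(x_k))$, and $z_k:=z_k(\alpha_k)$, where $\alpha_k>0$ satisfies: (a) $m_k(z_k)\le m_k(x_k)+\nu_0\langle\nabla m_k(x_k),z_k-x_k\rangle$ and $\|z_k-x_k\|_\infty\le\nu_2\Delta$; (b) $\alpha_k\in[\nu_4,\nu_5]$, or $\alpha_k\in[\nu_3\bar\alpha_k,\nu_5]$ for some $\bar\alpha_k>0$ such that $m_k(z_k(\bar\alpha_k))>m_k(x_k)+\nu_0\langle\nabla m_k(x_k),z_k(\bar\alpha_k)-x_k\rangle$ or $\|z_k(\bar\alpha_k)-x_k\|_\infty\ge\nu_1\Delta$. The Cauchy point is $z=z^l:=(z_1^\top,\dots,z_K^\top)^\top$. (2) Refinement. Find $y=y^l\in\Omega$ with $m(x)-m(y)\ge\gamma_1(m(x)-m(z))$, $\|y-x\|_\infty\le\gamma_2\Delta$, $\mathcal{A}_{\Omega_k}(z_k)\subseteq\mathcal{A}_{\Omega_k}(y_k)$ for all $k$. It is obtained by a monotone (safeguarded conjugate gradient) method started at $z$ on the regularised objective $m(y)+\frac{\sigma^l}{2}\|y-z\|_2^2$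 with $\sigma^l\in(\underline\sigma,\bar\sigma)$, so that $m(y)+\frac{\sigma^l}{2}\|y-z\|_2^2\le m(z)$. (3) Update. $\rho^l:=\frac{L(x)-L(y)}{m(x)-m(y)}$. If $\rho^l<\eta_1$: $x^{l+1}=x^l$, $\Delta^{l+1}\in[\sigma_1\Delta^l,\sigma_2\Delta^l]$. If $\rho^l\in[\eta_1,\eta_2]$: $x^{l+1}=y^l$, $\Delta^{l+1}\in[\sigma_1\Delta^l,\sigma_3\Delta^l]$. If $\rho^l>\eta_2$: $x^{l+1}=y^l$, $\Delta^{l+1}\in[\Delta^l,\sigma_3\Delta^l]$. The stopping tolerance is taken to be $0$ and no iterate is critical, so that infinite sequences are generated. *)

theory Defs
  imports "HOL-Analysis.Analysis"
begin

section \<open>Gradient and Hessian\<close>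

definition grad :: "('a::euclidean_space \<Rightarrow> real) \<Rightarrow> 'a \<Rightarrow> 'a" where
  "grad f x = (THE D. GDERIV f x :> D)"

definition hessian :: "(real ^ 'n \<Rightarrow> real) \<Rightarrow> real ^ 'n \<Rightarrow> real ^ 'n ^ 'n" where
  "hessian f x = jacobian (grad f) (at x)"

section \<open>Cones and criticality\<close>

definition normal_cone :: "'a::euclidean_space set \<Rightarrow> 'a \<Rightarrow> 'a set" where
  "normal_cone S x = {v. \<forall>y\<in>S. v \<bullet> (y - x) \<le> 0}"

text \<open>The tangent cone of a convex set is the closure of its cone of feasible directions.\<close>

definition tangent_cone :: "'a::euclidean_space set \<Rightarrow> 'a \<Rightarrow> 'a set" where
  "tangent_cone S x = closure {d. \<exists>t>0. \<forall>s\<in>{0..t}. x + s *\<^sub>R d \<in> S}"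

definition proj_grad :: "'a::euclidean_space set \<Rightarrow> ('a \<Rightarrow> real) \<Rightarrow> 'a \<Rightarrow> 'a" where
  "proj_grad S f x = closest_point (tangent_cone S x) (- grad f x)"

definition critical_point :: "'a::euclidean_space set \<Rightarrow> ('a \<Rightarrow> real) \<Rightarrow> 'a \<Rightarrow> bool" where
  "critical_point S f x \<longleftrightarrow> x \<in> S \<and> proj_grad S f x = 0"

definition nondegenerate :: "'a::euclidean_space set \<Rightarrow> ('a \<Rightarrow> real) \<Rightarrow> 'a \<Rightarrow> bool" where
  "nondegenerate S f x \<longleftrightarrow> x \<in> S \<and> - grad f x \<in> rel_interior (normal_cone S x)"

section \<open>Block structure and polyhedral constraints\<close>

text \<open>
  The splitting of \<open>\<real>\<^sup>n\<close> into blocks \<open>k = 1, \<dots>, K\<close> (with \<open>K = num_blocks\<close>) is given by a map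
  \<open>block_of\<close> that sends each coordinate to the number of its block.  The space of the
  \<open>k\<close>-th block is represented by the coordinate subspace \<open>block_space\<close>, i.e. a block vector is
  padded with zeros; this preserves inner products and the Euclidean and maximum norms.
  The \<open>k\<close>-th polyhedron has \<open>num_cons k\<close> inequalities, with normals \<open>con_normal k i\<close> and right-hand
  sides \<open>con_rhs k i\<close> for \<open>i = 1, \<dots>, num_cons k\<close>.
\<close>

record ('n::finite) block_constraints =
  num_blocks :: nat
  block_of :: "'n \<Rightarrow> nat"
  num_cons :: "nat \<Rightarrow> nat"
  con_normal :: "nat \<Rightarrow> nat \<Rightarrow> real ^ 'n"
  con_rhs :: "nat \<Rightarrow> nat \<Rightarrow> real"

definition block_space :: "('n::finite) block_constraints \<Rightarrow> nat \<Rightarrow> (real ^ 'n) set" where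
  "block_space C k = {u. \<forall>j. block_of C j \<noteq> k \<longrightarrow> u $ j = 0}"

definition block :: "('n::finite) block_constraints \<Rightarrow> nat \<Rightarrow> real ^ 'n \<Rightarrow> real ^ 'n" where
  "block C k x = (\<chi> j. if block_of C j = k then x $ j else 0)"

definition wf_constraints :: "('n::finite) block_constraints \<Rightarrow> bool" where
  "wf_constraints C \<longleftrightarrow>
     (\<forall>j. block_of C j \<in> {1..num_blocks C}) \<and>
     (\<forall>k\<in>{1..num_blocks C}. \<forall>i\<in>{1..num_cons C k}. con_normal C k i \<in> block_space C k)"

definition Omega_block :: "('n::finite) block_constraints \<Rightarrow> nat \<Rightarrow> (real ^ 'n) set" where
  "Omega_block C k =
     {u \<in> block_space C k. \<forall>i\<in>{1..num_cons C k}. con_normal C k i \<bullet> u \<le> con_rhs C k i}"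

definition Omega :: "('n::finite) block_constraints \<Rightarrow> (real ^ 'n) set" where
  "Omega C = {x. \<forall>k\<in>{1..num_blocks C}. block C k x \<in> Omega_block C k}"

definition active_block :: "('n::finite) block_constraints \<Rightarrow> nat \<Rightarrow> real ^ 'n \<Rightarrow> nat set" where
  "active_block C k u = {i \<in> {1..num_cons C k}. con_normal C k i \<bullet> u = con_rhs C k i}"

definition active :: "('n::finite) block_constraints \<Rightarrow> real ^ 'n \<Rightarrow> (nat \<times> nat) set" where
  "active C x = {(k, i). k \<in> {1..num_blocks C} \<and> i \<in> active_block C k (block C k x)}"

section \<open>The trust region algorithm with alternating projections\<close>

record trap_params =
  Delta0 :: real
  sigma1 :: real
  sigma2 :: real
  sigma3 :: real
  eta1 :: real
  eta2 :: real
  gamma1 :: real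
  gamma2 :: real
  nu0 :: real
  nu1 :: real
  nu2 :: real
  nu3 :: real
  nu4 :: real
  nu5 :: real
  sigma_lo :: real
  sigma_hi :: real

definition valid_params :: "trap_params \<Rightarrow> bool" where
  "valid_params p \<longleftrightarrow>
     0 < Delta0 p \<and>
     0 < sigma1 p \<and> sigma1 p < sigma2 p \<and> sigma2 p < 1 \<and> 1 < sigma3 p \<and>
     0 < eta1 p \<and> eta1 p < eta2 p \<and> eta2 p < 1 \<and>
     0 < gamma1 p \<and> gamma1 p < 1 \<and> 0 < gamma2 p \<and>
     0 < nu0 p \<and> nu0 p < 1 \<and> 0 < nu1 p \<and> nu1 p < nu2 p \<and>
     0 < nu3 p \<and> 0 < nu4 p \<and> 0 < nu5 p \<and>
     0 < sigma_lo p \<and> sigma_lo p < sigma_hi p"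

definition model ::
  "(real ^ 'n \<Rightarrow> real) \<Rightarrow> (real ^ 'n \<Rightarrow> real ^ 'n ^ 'n) \<Rightarrow> real ^ 'n \<Rightarrow> real ^ 'n \<Rightarrow> real" where
  "model L B x x' =
     L x + grad L x \<bullet> (x' - x) + (1 / 2) * ((x' - x) \<bullet> (B x *v (x' - x)))"

text \<open>
  \<open>block_model C L B x z k\<close> is \<open>m\<^sub>k(u) = m(z\<^sub>1, \<dots>, z\<^sub>k\<^sub>-\<^sub>1, u, x\<^sub>k\<^sub>+\<^sub>1, \<dots>, x\<^sub>K)\<close>.  It depends only on the
  \<open>k\<close>-th block of its argument, so its gradient lies in \<open>block_space C k\<close> and is the
  zero-padded gradient with respect to that block.
\<close>

definition block_model ::
  "('n::finite) block_constraints \<Rightarrow> (real ^ 'n \<Rightarrow> real) \<Rightarrow> (real ^ 'n \<Rightarrow> real ^ 'n ^ 'n) \<Rightarrow>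
   real ^ 'n \<Rightarrow> real ^ 'n \<Rightarrow> nat \<Rightarrow> real ^ 'n \<Rightarrow> real" where
  "block_model C L B x z k u =
     model L B x
       (\<chi> j. if block_of C j < k then z $ j else if block_of C j = k then u $ j else x $ j)"

definition block_step ::
  "('n::finite) block_constraints \<Rightarrow> (real ^ 'n \<Rightarrow> real) \<Rightarrow> (real ^ 'n \<Rightarrow> real ^ 'n ^ 'n) \<Rightarrow>
   real ^ 'n \<Rightarrow> real ^ 'n \<Rightarrow> nat \<Rightarrow> real \<Rightarrow> real ^ 'n" where
  "block_step C L B x z k \<alpha> =
     closest_point (Omega_block C k)
       (block C k x - \<alpha> *\<^sub>R grad (block_model C L B x z k) (block C k x))"

definition cauchy_point ::
  "trap_params \<Rightarrow> ('n::finite) block_constraints \<Rightarrow> (real ^ 'n \<Rightarrow> real) \<Rightarrow>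
   (real ^ 'n \<Rightarrow> real ^ 'n ^ 'n) \<Rightarrow> real ^ 'n \<Rightarrow> real \<Rightarrow> real ^ 'n \<Rightarrow> bool" where
  "cauchy_point p C L B x \<Delta> z \<longleftrightarrow>
     (\<forall>k\<in>{1..num_blocks C}. \<exists>\<alpha>>0.
        let mk = block_model C L B x z k;
            xk = block C k x;
            zk = block C k z;
            step = block_step C L B x z k
        in zk = step \<alpha> \<and>
           mk zk \<le> mk xk + nu0 p * (grad mk xk \<bullet> (zk - xk)) \<and>
           infnorm (zk - xk) \<le> nu2 p * \<Delta> \<and>
           (\<alpha> \<in> {nu4 p..nu5 p} \<or>
            (\<exists>\<alpha>'>0. \<alpha> \<in> {nu3 p * \<alpha>'..nu5 p} \<and>
               (mk (step \<alpha>') > mk xk + nu0 p * (grad mk xk \<bullet> (step \<alpha>' - xk)) \<or>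
                infnorm (step \<alpha>' - xk) \<ge> nu1 p * \<Delta>))))"

text \<open>
  Of the monotone method that computes \<open>y\<close> from \<open>z\<close>, only the resulting decrease of the regularised
  objective is recorded.
\<close>

definition refinement ::
  "trap_params \<Rightarrow> ('n::finite) block_constraints \<Rightarrow> (real ^ 'n \<Rightarrow> real) \<Rightarrow>
   (real ^ 'n \<Rightarrow> real ^ 'n ^ 'n) \<Rightarrow> real ^ 'n \<Rightarrow> real \<Rightarrow> real ^ 'n \<Rightarrow> real ^ 'n \<Rightarrow> bool" where
  "refinement p C L B x \<Delta> z y \<longleftrightarrow>
     y \<in> Omega C \<and>
     model L B x x - model L B x y \<ge> gamma1 p * (model L B x x - model L B x z) \<and>
     infnorm (y - x) \<le> gamma2 p * \<Delta> \<and>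
     (\<forall>k\<in>{1..num_blocks C}. active_block C k (block C k z) \<subseteq> active_block C k (block C k y)) \<and>
     (\<exists>\<sigma>\<in>{sigma_lo p<..<sigma_hi p}.
        model L B x y + \<sigma> / 2 * (norm (y - z))\<^sup>2 \<le> model L B x z)"

definition trap_update ::
  "trap_params \<Rightarrow> (real ^ 'n \<Rightarrow> real) \<Rightarrow> (real ^ 'n \<Rightarrow> real ^ 'n ^ 'n) \<Rightarrow>
   real ^ 'n \<Rightarrow> real \<Rightarrow> real ^ 'n \<Rightarrow> real ^ 'n \<Rightarrow> real \<Rightarrow> bool" where
  "trap_update p L B x \<Delta> y x' \<Delta>' \<longleftrightarrow>
     (let \<rho> = (L x - L y) / (model L B x x - model L B x y)
      in (\<rho> < eta1 p \<longrightarrow> x' = x \<and> \<Delta>' \<in> {sigma1 p * \<Delta>..sigma2 p * \<Delta>}) \<and>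
         (\<rho> \<in> {eta1 p..eta2 p} \<longrightarrow> x' = y \<and> \<Delta>' \<in> {sigma1 p * \<Delta>..sigma3 p * \<Delta>}) \<and>
         (\<rho> > eta2 p \<longrightarrow> x' = y \<and> \<Delta>' \<in> {\<Delta>..sigma3 p * \<Delta>}))"

definition trap_sequence ::
  "trap_params \<Rightarrow> ('n::finite) block_constraints \<Rightarrow> (real ^ 'n \<Rightarrow> real) \<Rightarrow>
   (real ^ 'n \<Rightarrow> real ^ 'n ^ 'n) \<Rightarrow> real ^ 'n \<Rightarrow> (nat \<Rightarrow> real ^ 'n) \<Rightarrow> (nat \<Rightarrow> real) \<Rightarrow> bool" where
  "trap_sequence p C L B x0 x \<Delta> \<longleftrightarrow>
     x 0 = x0 \<and> \<Delta> 0 = Delta0 p \<and>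
     (\<forall>l. \<exists>z y. cauchy_point p C L B (x l) (\<Delta> l) z \<and>
                refinement p C L B (x l) (\<Delta> l) z y \<and>
                trap_update p L B (x l) (\<Delta> l) y (x (Suc l)) (\<Delta> (Suc l)))"

end

theory Submission
  imports Defs
begin

text \<open>
  Nondegeneracy makes \<open>L\<close> grow linearly in the component of \<open>x - xs\<close> along the span of the normal cone
  at the limit point \<open>xs\<close> (the distance of \<open>x\<close> to the face of \<open>xs\<close>), and the second-order condition makes
  it grow quadratically in the complementary component.  So \<open>L\<close> has a strict local minimum at \<open>xs\<close>;
  as \<open>L\<close> decreases along the iterates and accepted steps tend to zero, the whole sequence converges.

  For the active set, let \<open>D\<close> be the distance of the iterate to the face.  Late in the run, an accepted step
  that does not land on the face requires \<open>\<Delta> \<le> M D\<close>.  Conversely, for every \<open>M'\<close>, late iterations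
  with \<open>\<Delta> \<le> M' D\<close> are very successful, since the model decrease is then linear in \<open>\<Delta>\<close>.  Take
  \<open>M' = M / sigma1\<close> and suppose the face is never reached: a rejection means \<open>\<Delta> > M' D\<close>, hence
  \<open>\<Delta> > M D\<close> after the reduction, hence another rejection, and so on forever; but if all late steps are
  accepted, then \<open>\<Delta>\<close> does not decrease, although \<open>\<Delta> \<le> M D\<close> tends to zero.  Once on the face, \<open>D = 0\<close>
  rules out leaving it.
\<close>

section \<open>Gradients and projections\<close>

text \<open>The bound of \<Delta> by \<open>D\<close> has the following source. Near
  \<open>xs\<close> the negative gradient pushes towards the face with a strength of at least some
  \<epsilon> > 0, so a projected step of length \<alpha> can miss the face only if
  \<open>\<epsilon> * \<alpha> \<le> 2 * D\<close>. The step-size rule bounds \<alpha> from below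
  either by a constant or by a multiple of \<Delta>; once \<open>D\<close> is small, the constant is
  excluded, and the multiple of \<Delta> is at most of order \<open>D\<close>. The steps are taken
  block by block while the face belongs to the whole polyhedron; the two fit together because the
  span of the normal cone is invariant under passing to a block. No uniform positive lower bound for
  the radius is available a priori, which is why \<Delta> is measured against \<open>D\<close> and
  not against a constant.\<close>

lemma grad_eqI:
  assumes "GDERIV f x :> D"
  shows "grad f x = D"
  unfolding grad_def
proof (rule the_equality)
  show "GDERIV f x :> D" by fact
next
  fix D' assume "GDERIV f x :> D'"
  from this assms have "(\<lambda>h. h \<bullet> D') = (\<lambda>h. h \<bullet> D)"
    unfolding gderiv_def by (rule has_derivative_unique)
  then have "h \<bullet> (D' - D) = 0" for h
    unfolding inner_diff_right fun_eq_iff by simp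
  then show "D' = D" using inner_eq_zero_iff[of "D' - D"] by simp
qed

lemma has_derivative_grad:
  assumes "f differentiable (at x)"
  shows "(f has_derivative (\<lambda>h. h \<bullet> grad f x)) (at x)"
proof -
  obtain f' where f': "(f has_derivative f') (at x)"
    using assms unfolding differentiable_def by blast
  then have "linear f'" using has_derivative_linear by blast
  \<comment> \<open>The vector representing the functional \<open>f'\<close> is the adjoint applied
    to the unit \<open>1\<close> of the real line.\<close>
  then have "f' = (\<lambda>h. h \<bullet> adjoint f' 1)"
    using adjoint_works[of f' _ 1] by (simp add: fun_eq_iff)
  with f' have D: "GDERIV f x :> adjoint f' 1"
    unfolding gderiv_def by (rule has_derivative_eq_rhs)
  then show ?thesis
    unfolding grad_eqI[OF D] gderiv_def .
qed

text \<open>Mean value inequality for \<open>f\<close> minus its linear part at \<open>x\<close>.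
  Only gradients on the convex set \<open>S\<close> enter, so \<open>S\<close> can be cut down to a
  small neighbourhood.\<close>

lemma first_order_remainder:
  fixes f :: "'a::euclidean_space \<Rightarrow> real"
  assumes "convex S" "x \<in> S" "y \<in> S" "\<And>w. w \<in> S \<Longrightarrow> f differentiable (at w)"
    and "\<And>w. w \<in> S \<Longrightarrow> norm (grad f w - grad f x) \<le> \<eta>"
  shows "\<bar>f y - f x - grad f x \<bullet> (y - x)\<bar> \<le> \<eta> * norm (y - x)"
proof -
  define h where "h w = f w - w \<bullet> grad f x" for w
  have "norm (h y - h x) \<le> \<eta> * norm (y - x)"
  proof (rule differentiable_bound[OF \<open>convex S\<close> _ _ \<open>y \<in> S\<close> \<open>x \<in> S\<close>])
    fix w assume w: "w \<in> S"
    show "(h has_derivative (\<lambda>d. d \<bullet> (grad f w - grad f x))) (at w within S)"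
      unfolding h_def inner_diff_right
      by (intro has_derivative_diff has_derivative_inner_left has_derivative_ident
          has_derivative_at_withinI[OF has_derivative_grad[OF assms(4)[OF w]]])
    show "onorm (\<lambda>d. d \<bullet> (grad f w - grad f x)) \<le> \<eta>"
    proof (rule onorm_le)
      fix d
      have "norm (d \<bullet> (grad f w - grad f x)) \<le> norm d * norm (grad f w - grad f x)"
        by (simp add: Cauchy_Schwarz_ineq2)
      also have "\<dots> \<le> norm d * \<eta>"
        using assms(5)[OF w] by (intro mult_left_mono) auto
      finally show "norm (d \<bullet> (grad f w - grad f x)) \<le> \<eta> * norm d"
        by (simp add: mult.commute)
    qed
  qed
  then show ?thesis
    unfolding h_def by (simp add: inner_diff_right inner_commute algebra_simps)
qed

text \<open>The gradient is differentiable at the single point \<open>x\<close> only, so the mean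
  value inequality replaces a Taylor formula: along the segment, the derivative of the remainder
  \<phi> is the first-order error of the gradient, paired with the direction.\<close>

lemma second_order_remainder:
  fixes f :: "real ^ 'n \<Rightarrow> real"
  assumes "convex S" "x \<in> S" "\<And>w. w \<in> S \<Longrightarrow> f differentiable (at w)"
    and "grad f differentiable (at x)" "0 < \<eta>"
  obtains \<delta> where "0 < \<delta>"
    "\<And>y. y \<in> S \<Longrightarrow> norm (y - x) < \<delta> \<Longrightarrow>
       \<bar>f y - f x - grad f x \<bullet> (y - x) - (y - x) \<bullet> (hessian f x *v (y - x)) / 2\<bar>
         \<le> \<eta> * (norm (y - x))\<^sup>2"
proof -
  define H where "H = hessian f x"
  have "(grad f has_derivative (\<lambda>h. H *v h)) (at x)"
    using assms(4) unfolding H_def hessian_def by (simp add: jacobian_works)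
  then obtain \<delta> where \<delta>: "\<delta> > 0"
    "\<And>w. norm (w - x) < \<delta> \<Longrightarrow> norm (grad f w - grad f x - H *v (w - x)) \<le> \<eta> * norm (w - x)"
    unfolding has_derivative_at_alt using \<open>0 < \<eta>\<close> by meson
  have "\<bar>f y - f x - grad f x \<bullet> (y - x) - (y - x) \<bullet> (H *v (y - x)) / 2\<bar> \<le> \<eta> * (norm (y - x))\<^sup>2"
    if y: "y \<in> S" "norm (y - x) < \<delta>" for y
  proof -
    define d where "d = y - x"
    define \<phi> where "\<phi> t = f (x + t *\<^sub>R d) - t * (grad f x \<bullet> d) - t\<^sup>2 * (d \<bullet> (H *v d)) / 2" for t :: real
    have "norm (\<phi> 1 - \<phi> 0) \<le> (\<eta> * (norm d)\<^sup>2) * norm (1 - 0 :: real)"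
    proof (rule differentiable_bound[OF convex_real_interval(5)])
      fix t :: real assume t: "t \<in> {0..1}"
      let ?w = "x + t *\<^sub>R d"
      have "?w = (1 - t) *\<^sub>R x + t *\<^sub>R y" unfolding d_def by (simp add: algebra_simps)
      then have w: "?w \<in> S"
        using t convexD[OF \<open>convex S\<close> \<open>x \<in> S\<close> \<open>y \<in> S\<close>, of "1 - t" t] by auto
      let ?D = "(grad f ?w - grad f x - H *v (t *\<^sub>R d)) \<bullet> d"
      have "((\<lambda>t. x + t *\<^sub>R d) has_derivative (\<lambda>h. h *\<^sub>R d)) (at t)"
        by (auto intro!: derivative_eq_intros)
      then have 1: "((\<lambda>t. f (x + t *\<^sub>R d)) has_derivative (\<lambda>h. (h *\<^sub>R d) \<bullet> grad f ?w)) (at t)"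
        using has_derivative_grad[OF assms(3)[OF w]] by (rule has_derivative_compose)
      have 2: "((\<lambda>t. t * a + t\<^sup>2 * b / 2) has_derivative (\<lambda>h. h * a + h * t * b)) (at t)" for a b :: real
        by (auto intro!: derivative_eq_intros)
      have "((\<lambda>t. f (x + t *\<^sub>R d) - (t * (grad f x \<bullet> d) + t\<^sup>2 * (d \<bullet> (H *v d)) / 2))
          has_derivative (\<lambda>h. h * ?D)) (at t)"
      proof (rule has_derivative_eq_rhs[OF has_derivative_diff[OF 1 2]], rule ext)
        fix h
        show "(h *\<^sub>R d) \<bullet> grad f ?w - (h * (grad f x \<bullet> d) + h * t * (d \<bullet> (H *v d))) = h * ?D"
          by (simp add: inner_diff_left inner_commute[of d] matrix_vector_mult_scaleR right_diff_distrib)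
      qed
      then show "(\<phi> has_derivative (\<lambda>h. h * ?D)) (at t within {0..1})"
        unfolding \<phi>_def diff_diff_eq by (rule has_derivative_at_withinI)
      show "onorm (\<lambda>h. h * ?D) \<le> \<eta> * (norm d)\<^sup>2"
      proof (rule onorm_le)
        fix h :: real
        have nt: "norm (t *\<^sub>R d) \<le> norm d"
          using t by (simp add: mult_left_le_one_le)
        then have "norm (?w - x) < \<delta>" using y(2) unfolding d_def by simp
        from \<delta>(2)[OF this] have "norm (grad f ?w - grad f x - H *v (t *\<^sub>R d)) \<le> \<eta> * norm (t *\<^sub>R d)"
          by simp
        also have "\<dots> \<le> \<eta> * norm d"
          using nt \<open>0 < \<eta>\<close> by (intro mult_left_mono) auto
        finally have "norm (grad f ?w - grad f x - H *v (t *\<^sub>R d)) * norm d \<le> (\<eta> * norm d) * norm d"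
          by (rule mult_right_mono) simp
        then have "\<bar>?D\<bar> \<le> \<eta> * (norm d)\<^sup>2"
          using Cauchy_Schwarz_ineq2[of "grad f ?w - grad f x - H *v (t *\<^sub>R d)" d]
          by (simp add: power2_eq_square algebra_simps)
        then have "\<bar>h\<bar> * \<bar>?D\<bar> \<le> \<bar>h\<bar> * (\<eta> * (norm d)\<^sup>2)"
          by (rule mult_left_mono) simp
        then show "norm (h * ?D) \<le> \<eta> * (norm d)\<^sup>2 * norm h"
          by (simp add: abs_mult mult.commute)
      qed
    qed auto
    then show ?thesis
      unfolding \<phi>_def d_def by (simp add: algebra_simps)
  qed
  then show ?thesis
    using \<delta>(1) that unfolding H_def by blast
qed

section \<open>Single steps of the projected gradient method\<close>

lemma projected_step_descent:
  fixes G :: "'a::euclidean_space"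
  assumes "convex S" "closed S" "x \<in> S" "z = closest_point S (x - \<alpha> *\<^sub>R G)"
  shows "(norm (z - x))\<^sup>2 \<le> \<alpha> * - (G \<bullet> (z - x))"
proof -
  have "(x - \<alpha> *\<^sub>R G - z) \<bullet> (x - z) \<le> 0"
    using closest_point_dot[OF assms(1-3)] unfolding assms(4) .
  then show ?thesis
    by (simp add: power2_norm_eq_inner inner_diff_left inner_diff_right inner_commute algebra_simps)
qed

lemma projected_step_length:
  fixes G :: "'a::euclidean_space"
  assumes "convex S" "closed S" "x \<in> S" "z = closest_point S (x - \<alpha> *\<^sub>R G)" "0 < \<alpha>"
  shows "norm (z - x) \<le> \<alpha> * norm G"
proof -
  have "dist z x \<le> dist (x - \<alpha> *\<^sub>R G) x"
    using closest_point_lipschitz[OF assms(1,2), of "x - \<alpha> *\<^sub>R G" x] \<open>x \<in> S\<close>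
    unfolding closest_point_self[OF \<open>x \<in> S\<close>] assms(4) by blast
  then show ?thesis using \<open>0 < \<alpha>\<close> by (simp add: dist_norm)
qed

text \<open>The projected step minimises \<open>G \<bullet> s + |s|\<^sup>2 / (2 \<alpha>)\<close>; compare it with the step \<open>- t d\<close>, where \<open>t\<close>
  is the largest value in \<open>[0, 1]\<close> with \<open>t |d| \<le> \<epsilon> \<alpha> / 2\<close>.\<close>

lemma projected_step_linear_decrease:
  fixes G :: "'a::euclidean_space"
  assumes S: "convex S" "closed S" "x \<in> S" "z = closest_point S (x - \<alpha> *\<^sub>R G)"
    and "0 < \<alpha>" "x - d \<in> S" "0 < \<epsilon>" "\<epsilon> / 2 * norm d \<le> G \<bullet> d"
  shows "\<epsilon> / 4 * min (norm d) (\<epsilon> / 2 * \<alpha>) \<le> - (G \<bullet> (z - x))"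
proof (cases "d = 0")
  case True
  have "0 \<le> \<alpha> * - (G \<bullet> (z - x))"
    using projected_step_descent[OF S] by (meson order_trans zero_le_power2)
  then have "0 \<le> - (G \<bullet> (z - x))" using \<open>0 < \<alpha>\<close> by (simp add: mult_le_0_iff)
  then show ?thesis using True assms by (simp add: min_def)
next
  case False
  define \<mu> where "\<mu> = min (norm d) (\<epsilon> / 2 * \<alpha>)"
  define t where "t = \<mu> / norm d"
  have td: "t * norm d = \<mu>" using False unfolding t_def by simp
  have \<mu>: "0 < \<mu>" using False assms unfolding \<mu>_def by simp
  have t: "0 < t" "t \<le> 1" using False \<mu> unfolding t_def \<mu>_def by (auto simp: divide_le_eq)
  have "(1 - t) *\<^sub>R x + t *\<^sub>R (x - d) \<in> S"
    using t assms by (intro convexD) auto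
  then have w: "x - t *\<^sub>R d \<in> S" by (simp add: algebra_simps)
  have "dist (x - \<alpha> *\<^sub>R G) z \<le> dist (x - \<alpha> *\<^sub>R G) (x - t *\<^sub>R d)"
    unfolding S(4) by (rule closest_point_le[OF S(2) w])
  then have "(norm (x - \<alpha> *\<^sub>R G - z))\<^sup>2 \<le> (norm (x - \<alpha> *\<^sub>R G - (x - t *\<^sub>R d)))\<^sup>2"
    by (simp add: dist_norm)
  \<comment> \<open>On expanding, both squares contain the squared norm of
    \<open>\<alpha> *\<^sub>R G\<close>, which cancels.\<close>
  then have "2 * \<alpha> * (t * (G \<bullet> d)) - (norm (t *\<^sub>R d))\<^sup>2 + (norm (z - x))\<^sup>2 \<le> 2 * \<alpha> * - (G \<bullet> (z - x))"
    unfolding power2_norm_eq_inner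
    by (simp add: inner_diff_left inner_diff_right inner_commute algebra_simps)
  moreover have "t * (\<epsilon> / 2 * norm d) \<le> t * (G \<bullet> d)"
    using t assms by (intro mult_left_mono) auto
  then have "2 * \<alpha> * (\<epsilon> / 2 * \<mu>) \<le> 2 * \<alpha> * (t * (G \<bullet> d))"
    using td \<open>0 < \<alpha>\<close> by (intro mult_left_mono) (auto simp: algebra_simps)
  moreover have "(norm (t *\<^sub>R d))\<^sup>2 = \<mu> * \<mu>"
    using t td by (simp add: power2_eq_square)
  \<comment> \<open>The cap on \<mu> lets the quadratic cost use up half of the linear gain
    \<open>\<epsilon> * \<alpha> * \<mu>\<close>. The other half, divided by the factor 2 in front,
    gives \<open>\<epsilon> / 4\<close>.\<close>
  moreover have "\<mu> * \<mu> \<le> \<epsilon> / 2 * \<alpha> * \<mu>"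
    using \<mu> by (intro mult_right_mono) (auto simp: \<mu>_def)
  moreover have "0 \<le> (norm (z - x))\<^sup>2" by simp
  ultimately have "2 * \<alpha> * (\<epsilon> / 2 * \<mu>) - \<epsilon> / 2 * \<alpha> * \<mu> \<le> 2 * \<alpha> * - (G \<bullet> (z - x))"
    by linarith
  then have "\<alpha> * (\<epsilon> / 4 * \<mu>) \<le> \<alpha> * - (G \<bullet> (z - x))"
    by (simp add: algebra_simps)
  then show ?thesis
    unfolding \<mu>_def mult_le_cancel_left_pos[OF \<open>0 < \<alpha>\<close>] .
qed

section \<open>Orthogonal projection onto a subspace\<close>

lemma closest_point_subspace_orthogonal:
  fixes S :: "'a::euclidean_space set"
  assumes "subspace S" "s \<in> S"
  shows "(v - closest_point S v) \<bullet> s = 0"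
proof -
  have S: "convex S" "closed S" "S \<noteq> {}"
    using assms subspace_imp_convex closed_subspace by auto
  have c: "closest_point S v \<in> S" using closest_point_in_set S by blast
  have "(v - closest_point S v) \<bullet> ((closest_point S v + s) - closest_point S v) \<le> 0"
    "(v - closest_point S v) \<bullet> ((closest_point S v - s) - closest_point S v) \<le> 0"
    using closest_point_dot[OF S(1,2)] c assms subspace_add subspace_diff by blast+
  then show ?thesis by simp
qed

lemma closest_point_subspace_eqI:
  fixes S :: "'a::euclidean_space set"
  assumes "subspace S" "a \<in> S" "\<And>s. s \<in> S \<Longrightarrow> (v - a) \<bullet> s = 0"
  shows "closest_point S v = a"
proof -
  have c: "closest_point S v \<in> S"
    using assms closest_point_in_set closed_subspace by blast
  then have "a - closest_point S v \<in> S" using assms subspace_diff by blast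
  then have "(v - a) \<bullet> (a - closest_point S v) = 0"
    "(v - closest_point S v) \<bullet> (a - closest_point S v) = 0"
    using assms(3) closest_point_subspace_orthogonal[OF assms(1)] by blast+
  then have "(a - closest_point S v) \<bullet> (a - closest_point S v) = 0"
    by (simp add: inner_diff_left inner_diff_right)
  then show ?thesis by simp
qed

section \<open>Blocks and polyhedra\<close>

lemma linear_block: "linear (block C k)"
  by (rule linearI) (auto simp: block_def vec_eq_iff)

lemmas block_diff = linear_diff[OF linear_block]

lemma block_in_block_space [simp]: "block C k x \<in> block_space C k"
  by (simp add: block_def block_space_def)

lemma block_block_space: "u \<in> block_space C k \<Longrightarrow> block C k u = u"
  by (auto simp: block_def block_space_def vec_eq_iff)

lemma block_block [simp]: "block C k (block C k x) = block C k x"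
  by (simp add: block_block_space)

lemma inner_block_left: "block C k x \<bullet> y = x \<bullet> block C k y"
  unfolding inner_vec_def block_def by (intro sum.cong) auto

lemma inner_block_block: "block C k x \<bullet> block C k y = block C k x \<bullet> y"
  by (metis inner_block_left block_block)

lemma norm_block_le: "norm (block C k x) \<le> norm x"
  by (rule norm_le_componentwise_cart) (auto simp: block_def)

lemma subspace_block_space: "subspace (block_space C k)"
  by (auto simp: subspace_def block_space_def)

lemma wf_con_normal:
  "wf_constraints C \<Longrightarrow> k \<in> {1..num_blocks C} \<Longrightarrow> i \<in> {1..num_cons C k} \<Longrightarrow>
    block C k (con_normal C k i) = con_normal C k i"
  by (simp add: wf_constraints_def block_block_space)

lemma sum_blocks:
  assumes "wf_constraints C"
  shows "(\<Sum>k\<in>{1..num_blocks C}. block C k x) = x"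
proof -
  have "(\<Sum>k\<in>{1..num_blocks C}. if block_of C j = k then x $ j else 0) = x $ j" for j
    using assms by (simp add: wf_constraints_def)
  then show ?thesis by (simp add: vec_eq_iff block_def)
qed

lemma norm_sq_blocks:
  assumes "wf_constraints C"
  shows "(norm x)\<^sup>2 = (\<Sum>k\<in>{1..num_blocks C}. (norm (block C k x))\<^sup>2)"
proof -
  have "(norm x)\<^sup>2 = (\<Sum>k\<in>{1..num_blocks C}. block C k x) \<bullet> x"
    unfolding sum_blocks[OF assms] by (rule power2_norm_eq_inner)
  also have "\<dots> = (\<Sum>k\<in>{1..num_blocks C}. (norm (block C k x))\<^sup>2)"
    by (simp add: inner_sum_left power2_norm_eq_inner inner_block_block)
  finally show ?thesis .
qed

lemma closed_Omega_block: "closed (Omega_block C k)"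
proof -
  have "Omega_block C k = block_space C k \<inter>
      (\<Inter>i\<in>{1..num_cons C k}. {u. con_normal C k i \<bullet> u \<le> con_rhs C k i})"
    by (auto simp: Omega_block_def)
  then show ?thesis
    by (auto intro!: closed_Int closed_INT closed_subspace[OF subspace_block_space]
        closed_halfspace_le)
qed

lemma convex_Omega_block: "convex (Omega_block C k)"
proof -
  have "Omega_block C k = block_space C k \<inter>
      (\<Inter>i\<in>{1..num_cons C k}. {u. con_normal C k i \<bullet> u \<le> con_rhs C k i})"
    by (auto simp: Omega_block_def)
  then show ?thesis
    by (auto intro!: convex_Int convex_INT subspace_imp_convex[OF subspace_block_space]
        convex_halfspace_le)
qed

lemma inner_con_normal_block:
  assumes "wf_constraints C" "k \<in> {1..num_blocks C}" "i \<in> {1..num_cons C k}"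
  shows "con_normal C k i \<bullet> block C k x = con_normal C k i \<bullet> x"
  using wf_con_normal[OF assms] by (metis inner_block_left)

text \<open>Each normal is supported on its own block, so the product of the blocks is one
  polyhedron in the full space, and constraints can be tested on \<open>x\<close> itself.\<close>

lemma mem_Omega_iff:
  assumes "wf_constraints C"
  shows "x \<in> Omega C \<longleftrightarrow>
    (\<forall>k\<in>{1..num_blocks C}. \<forall>i\<in>{1..num_cons C k}. con_normal C k i \<bullet> x \<le> con_rhs C k i)"
  using inner_con_normal_block[OF assms] unfolding Omega_def Omega_block_def by fastforce

lemma mem_active_iff:
  assumes "wf_constraints C"
  shows "(k, i) \<in> active C x \<longleftrightarrow>
    k \<in> {1..num_blocks C} \<and> i \<in> {1..num_cons C k} \<and> con_normal C k i \<bullet> x = con_rhs C k i"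
  using inner_con_normal_block[OF assms] unfolding active_def active_block_def by fastforce

lemma convex_Omega:
  assumes "wf_constraints C"
  shows "convex (Omega C)"
proof -
  have "Omega C = (\<Inter>k\<in>{1..num_blocks C}. \<Inter>i\<in>{1..num_cons C k}.
      {x. con_normal C k i \<bullet> x \<le> con_rhs C k i})"
    using mem_Omega_iff[OF assms] by auto
  then show ?thesis by (auto intro!: convex_INT convex_halfspace_le)
qed

text \<open>Feasibility is decided block by block, so one block can be exchanged alone. At
  \<open>xs\<close> this makes the normal cone invariant under taking blocks.\<close>

lemma Omega_replace_block:
  assumes "wf_constraints C" "x \<in> Omega C" "y \<in> Omega C"
  shows "x + block C k (y - x) \<in> Omega C"
  unfolding mem_Omega_iff[OF assms(1)]
proof (intro ballI)
  fix k' i assume ki: "k' \<in> {1..num_blocks C}" "i \<in> {1..num_cons C k'}"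
  let ?\<omega> = "con_normal C k' i"
  have "?\<omega> \<bullet> (x + block C k (y - x)) = ?\<omega> \<bullet> (if k' = k then y else x)"
  proof (cases "k' = k")
    case True
    then show ?thesis
      using inner_con_normal_block[OF assms(1) ki, of "y - x"] by (simp add: inner_add_right inner_diff_right)
  next
    case False
    have "block C k' (block C k (y - x)) = 0"
      using False by (auto simp: block_def vec_eq_iff)
    then have "?\<omega> \<bullet> block C k (y - x) = 0"
      using inner_con_normal_block[OF assms(1) ki, of "block C k (y - x)"] by simp
    then show ?thesis using False by (simp add: inner_add_right)
  qed
  also have "\<dots> \<le> con_rhs C k' i"
    using assms ki by (auto simp: mem_Omega_iff)
  finally show "?\<omega> \<bullet> (x + block C k (y - x)) \<le> con_rhs C k' i" .
qed

lemma finite_constraint_indices: "finite {(k, i). k \<in> {1..num_blocks C} \<and> i \<in> {1..num_cons C k}}"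
proof -
  have "{(k, i). k \<in> {1..num_blocks C} \<and> i \<in> {1..num_cons C k}} =
      Sigma {1..num_blocks C} (\<lambda>k. {1..num_cons C k})" by auto
  then show ?thesis by simp
qed

text \<open>The inactive constraints are finitely many strict continuous inequalities, so one radius
  serves them all.\<close>

lemma inactive_near:
  fixes C :: "('n::finite) block_constraints"
  assumes "wf_constraints C" "xs \<in> Omega C"
  obtains r where "0 < r"
    "\<And>x k i. norm (x - xs) < r \<Longrightarrow> k \<in> {1..num_blocks C} \<Longrightarrow> i \<in> {1..num_cons C k} \<Longrightarrow>
       (k, i) \<notin> active C xs \<Longrightarrow> con_normal C k i \<bullet> x < con_rhs C k i"
proof -
  let ?I = "{(k, i). k \<in> {1..num_blocks C} \<and> i \<in> {1..num_cons C k}} - active C xs"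
  have "\<forall>\<^sub>F x in nhds xs. \<forall>ki\<in>?I. con_normal C (fst ki) (snd ki) \<bullet> x < con_rhs C (fst ki) (snd ki)"
  proof (rule eventually_ball_finite)
    show "finite ?I" using finite_constraint_indices by (rule finite_Diff)
    show "\<forall>ki\<in>?I. \<forall>\<^sub>F x in nhds xs. con_normal C (fst ki) (snd ki) \<bullet> x < con_rhs C (fst ki) (snd ki)"
    proof
      fix ki assume ki: "ki \<in> ?I"
      have "con_normal C (fst ki) (snd ki) \<bullet> xs < con_rhs C (fst ki) (snd ki)"
        using ki assms by (force simp: mem_Omega_iff mem_active_iff order.strict_iff_order)
      moreover have "((\<lambda>x. con_normal C (fst ki) (snd ki) \<bullet> x) \<longlongrightarrow> con_normal C (fst ki) (snd ki) \<bullet> xs) (nhds xs)"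
        by (intro tendsto_inner tendsto_const filterlim_ident)
      ultimately show "\<forall>\<^sub>F x in nhds xs. con_normal C (fst ki) (snd ki) \<bullet> x < con_rhs C (fst ki) (snd ki)"
        by (rule order_tendstoD(2)[rotated])
    qed
  qed
  then obtain r where "r > 0"
    "\<And>x. dist x xs < r \<Longrightarrow> \<forall>ki\<in>?I. con_normal C (fst ki) (snd ki) \<bullet> x < con_rhs C (fst ki) (snd ki)"
    unfolding eventually_nhds_metric by blast
  then show ?thesis
    by (intro that[of r]) (force simp: dist_norm)+
qed

text \<open>For a polyhedron the cone of feasible directions is already closed, being cut out by the
  active constraints. In particular the tangent cone depends on \<open>x\<close> only through
  \<open>active C x\<close>.\<close>

lemma tangent_cone_Omega:
  fixes C :: "('n::finite) block_constraints"
  assumes "wf_constraints C" "x \<in> Omega C"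
  shows "tangent_cone (Omega C) x = {d. \<forall>(k, i)\<in>active C x. con_normal C k i \<bullet> d \<le> 0}"
    (is "_ = ?T")
proof -
  have "{d. \<exists>t>0. \<forall>s\<in>{0..t}. x + s *\<^sub>R d \<in> Omega C} = ?T"
  proof (intro equalityI subsetI)
    fix d assume "d \<in> {d. \<exists>t>0. \<forall>s\<in>{0..t}. x + s *\<^sub>R d \<in> Omega C}"
    then obtain t where t: "t > 0" "x + t *\<^sub>R d \<in> Omega C" by force
    have "con_normal C k i \<bullet> d \<le> 0" if "(k, i) \<in> active C x" for k i
    proof -
      have "con_normal C k i \<bullet> (x + t *\<^sub>R d) \<le> con_normal C k i \<bullet> x"
        using that t(2) assms(1) by (simp add: mem_Omega_iff mem_active_iff)
      then show ?thesis using t(1) by (simp add: inner_add_right mult_le_0_iff)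
    qed
    then show "d \<in> ?T" by auto
  next
    fix d assume d: "d \<in> ?T"
    obtain r where r: "0 < r"
      "\<And>y k i. norm (y - x) < r \<Longrightarrow> k \<in> {1..num_blocks C} \<Longrightarrow> i \<in> {1..num_cons C k} \<Longrightarrow>
       (k, i) \<notin> active C x \<Longrightarrow> con_normal C k i \<bullet> y < con_rhs C k i"
      using inactive_near[OF assms] by blast
    \<comment> \<open>Short enough to keep the inactive constraints strict; the summand 1 covers
      \<open>d = 0\<close>.\<close>
    define t where "t = r / (2 * (norm d + 1))"
    have t: "0 < t" "t * norm d < r"
    proof -
      have n: "0 < norm d + 1" by (simp add: add_nonneg_pos)
      then show "0 < t" using r(1) unfolding t_def by (intro divide_pos_pos) auto
      have "t * norm d < t * (2 * (norm d + 1))"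
      proof (rule mult_strict_left_mono)
        show "norm d < 2 * (norm d + 1)" by (smt (verit) norm_ge_zero)
      qed fact
      moreover have "2 * (norm d + 1) \<noteq> 0" using n by simp
      then have "t * (2 * (norm d + 1)) = r"
        by (simp only: t_def times_divide_eq_left nonzero_mult_div_cancel_right not_False_eq_True)
      ultimately show "t * norm d < r" by simp
    qed
    have "x + s *\<^sub>R d \<in> Omega C" if s: "s \<in> {0..t}" for s
      unfolding mem_Omega_iff[OF assms(1)]
    proof (intro ballI)
      fix k i assume ki: "k \<in> {1..num_blocks C}" "i \<in> {1..num_cons C k}"
      show "con_normal C k i \<bullet> (x + s *\<^sub>R d) \<le> con_rhs C k i"
      proof (cases "(k, i) \<in> active C x")
        case True
        then have "con_normal C k i \<bullet> x = con_rhs C k i" "con_normal C k i \<bullet> d \<le> 0"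
          using d by (auto simp: mem_active_iff[OF assms(1)])
        then show ?thesis using s by (simp add: inner_add_right mult_nonneg_nonpos)
      next
        case False
        have "s * norm d \<le> t * norm d" using s by (intro mult_right_mono) auto
        then have "norm ((x + s *\<^sub>R d) - x) < r" using s t by simp
        then show ?thesis using r(2) ki False by (simp add: less_imp_le)
      qed
    qed
    then show "d \<in> {d. \<exists>t>0. \<forall>s\<in>{0..t}. x + s *\<^sub>R d \<in> Omega C}" using t by blast
  qed
  moreover have "closed ?T"
  proof -
    have "?T = (\<Inter>(k, i)\<in>active C x. {d. con_normal C k i \<bullet> d \<le> 0})" by auto
    then show ?thesis by (auto intro!: closed_INT closed_halfspace_le)
  qed
  ultimately show ?thesis unfolding tangent_cone_def by simp
qed

lemma tangent_cone_Omega_closed_convex: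
  fixes C :: "('n::finite) block_constraints"
  assumes "wf_constraints C" "x \<in> Omega C"
  shows "closed (tangent_cone (Omega C) x)" "convex (tangent_cone (Omega C) x)"
    "0 \<in> tangent_cone (Omega C) x"
proof -
  have *: "tangent_cone (Omega C) x = (\<Inter>(k, i)\<in>active C x. {d. con_normal C k i \<bullet> d \<le> 0})"
    using tangent_cone_Omega[OF assms] by auto
  show "convex (tangent_cone (Omega C) x)" "closed (tangent_cone (Omega C) x)" "0 \<in> tangent_cone (Omega C) x"
    unfolding * by (auto intro!: convex_INT convex_halfspace_le closed_INT closed_halfspace_le)
qed

section \<open>The normal part of a displacement\<close>

locale face_point =
  fixes C :: "('n::finite) block_constraints" and xs :: "real ^ 'n"
  assumes wf: "wf_constraints C" and xs_in: "xs \<in> Omega C"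
begin

abbreviation normal_space :: "(real ^ 'n) set" where
  "normal_space \<equiv> span (normal_cone (Omega C) xs)"

text \<open>The remainder \<open>v - normal_part v\<close> lies in the orthogonal complement of the
  normal cone, which is the space on which the Hessian will be assumed positive definite.\<close>

definition normal_part :: "real ^ 'n \<Rightarrow> real ^ 'n" where
  "normal_part = closest_point normal_space"

lemma normal_part_in: "normal_part v \<in> normal_space"
  unfolding normal_part_def
  by (rule closest_point_in_set) (auto simp: closed_span intro: span_zero)

lemma normal_part_orthogonal: "s \<in> normal_space \<Longrightarrow> (v - normal_part v) \<bullet> s = 0"
  unfolding normal_part_def by (rule closest_point_subspace_orthogonal[OF subspace_span])

lemma inner_normal_part: "s \<in> normal_space \<Longrightarrow> s \<bullet> normal_part v = s \<bullet> v"
  using normal_part_orthogonal[of s v] by (simp add: inner_commute[of _ s] inner_diff_right)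

lemma normal_part_eqI:
  "a \<in> normal_space \<Longrightarrow> (\<And>s. s \<in> normal_space \<Longrightarrow> (v - a) \<bullet> s = 0) \<Longrightarrow> normal_part v = a"
  unfolding normal_part_def by (rule closest_point_subspace_eqI[OF subspace_span])

lemma norm_sq_normal_part:
  "(norm v)\<^sup>2 = (norm (normal_part v))\<^sup>2 + (norm (v - normal_part v))\<^sup>2"
  using normal_part_orthogonal[OF normal_part_in, of v v]
  by (simp add: power2_norm_eq_inner inner_diff_left inner_diff_right inner_commute)

lemma norm_normal_part_le: "norm (normal_part v) \<le> norm v"
  using norm_sq_normal_part[of v] by (simp add: power2_le_imp_le)

lemma norm_tangential_part_le: "norm (v - normal_part v) \<le> norm v"
  using norm_sq_normal_part[of v] by (simp add: power2_le_imp_le)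

lemma tangential_part_in: "v - normal_part v \<in> orthogonal_comp (normal_cone (Omega C) xs)"
  using normal_part_orthogonal[of _ v] span_base
  by (force simp: orthogonal_comp_def orthogonal_def inner_commute)

text \<open>Test \<open>v\<close> with the feasible point that differs from \<open>xs\<close> in
  block \<open>k\<close> only.\<close>

lemma block_normal_cone:
  assumes "v \<in> normal_cone (Omega C) xs"
  shows "block C k v \<in> normal_cone (Omega C) xs"
  unfolding normal_cone_def
proof (intro CollectI ballI)
  fix y assume "y \<in> Omega C"
  then have "xs + block C k (y - xs) \<in> Omega C" by (rule Omega_replace_block[OF wf xs_in])
  then have "v \<bullet> (xs + block C k (y - xs) - xs) \<le> 0"
    using assms unfolding normal_cone_def by blast
  then show "block C k v \<bullet> (y - xs) \<le> 0" by (simp add: inner_block_left)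
qed

lemma block_normal_space:
  assumes "v \<in> normal_space"
  shows "block C k v \<in> normal_space"
proof -
  have "block C k v \<in> block C k ` normal_space" using assms by simp
  also have "\<dots> = span (block C k ` normal_cone (Omega C) xs)"
    by (rule linear_span_image[OF linear_block, symmetric])
  also have "\<dots> \<subseteq> normal_space"
    using block_normal_cone by (intro span_mono) auto
  finally show ?thesis .
qed

text \<open>The block projections are self-adjoint and leave the normal space invariant, hence
  commute with the projection onto it.\<close>

lemma normal_part_block: "normal_part (block C k v) = block C k (normal_part v)"
proof (rule normal_part_eqI)
  show "block C k (normal_part v) \<in> normal_space"
    by (rule block_normal_space[OF normal_part_in])
  fix s assume "s \<in> normal_space"
  then have "(v - normal_part v) \<bullet> block C k s = 0"
    by (intro normal_part_orthogonal block_normal_space)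
  then show "(block C k v - block C k (normal_part v)) \<bullet> s = 0"
    by (simp add: block_diff[symmetric] inner_block_left)
qed

lemma active_normal_in:
  assumes "(k, i) \<in> active C xs"
  shows "con_normal C k i \<in> normal_cone (Omega C) xs"
  using assms by (auto simp: normal_cone_def mem_active_iff[OF wf] mem_Omega_iff[OF wf] inner_diff_right)

text \<open>The point \<open>x - normal_part (x - xs)\<close> lies on the face of \<open>xs\<close>: it satisfies the constraints active at
  \<open>xs\<close> with equality.\<close>

lemma face_neighbourhood:
  obtains r where "0 < r"
    "\<And>x. norm (x - xs) < r \<Longrightarrow> x - normal_part (x - xs) \<in> Omega C"
    "\<And>x. norm (x - xs) < r \<Longrightarrow> active C x \<subseteq> active C xs"
    "\<And>x. norm (x - xs) < r \<Longrightarrow> x \<in> Omega C \<Longrightarrow>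
       active C xs \<subseteq> active C x \<longleftrightarrow> normal_part (x - xs) = 0"
proof -
  obtain r where r: "0 < r"
    "\<And>x k i. norm (x - xs) < r \<Longrightarrow> k \<in> {1..num_blocks C} \<Longrightarrow> i \<in> {1..num_cons C k} \<Longrightarrow>
       (k, i) \<notin> active C xs \<Longrightarrow> con_normal C k i \<bullet> x < con_rhs C k i"
    using inactive_near[OF wf xs_in] by blast
  have face: "x \<in> Omega C"
    if "norm (x - xs) < r" "\<And>k i. (k, i) \<in> active C xs \<Longrightarrow> con_normal C k i \<bullet> (x - xs) = 0" for x
    unfolding mem_Omega_iff[OF wf]
  proof (intro ballI)
    fix k i assume ki: "k \<in> {1..num_blocks C}" "i \<in> {1..num_cons C k}"
    show "con_normal C k i \<bullet> x \<le> con_rhs C k i"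
    proof (cases "(k, i) \<in> active C xs")
      case True
      then show ?thesis using that(2)[OF True] by (simp add: mem_active_iff[OF wf] inner_diff_right)
    next
      case False
      then show ?thesis using r(2)[OF that(1) ki] by simp
    qed
  qed
  show ?thesis
  proof (rule that[OF \<open>0 < r\<close>])
    fix x :: "real ^ 'n" assume x: "norm (x - xs) < r"
    show "x - normal_part (x - xs) \<in> Omega C"
    proof (rule face)
      have eq: "x - normal_part (x - xs) - xs = (x - xs) - normal_part (x - xs)" by simp
      show "norm (x - normal_part (x - xs) - xs) < r"
        unfolding eq using norm_tangential_part_le x by (rule order.strict_trans1)
      fix k i assume "(k, i) \<in> active C xs"
      then have "con_normal C k i \<in> normal_space" using active_normal_in span_base by blast
      then show "con_normal C k i \<bullet> (x - normal_part (x - xs) - xs) = 0"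
        using inner_normal_part[of "con_normal C k i" "x - xs"] by (simp add: inner_diff_right)
    qed
    show "active C x \<subseteq> active C xs"
    proof (rule subsetI)
      fix ki assume "ki \<in> active C x"
      then show "ki \<in> active C xs"
        using r(2)[OF x, of "fst ki" "snd ki"] by (cases ki) (force simp: mem_active_iff[OF wf])
    qed
    assume xO: "x \<in> Omega C"
    show "active C xs \<subseteq> active C x \<longleftrightarrow> normal_part (x - xs) = 0"
    proof
      assume sub: "active C xs \<subseteq> active C x"
      have perp: "con_normal C k i \<bullet> (x - xs) = 0" if "(k, i) \<in> active C xs" for k i
        using that subsetD[OF sub that] by (simp add: mem_active_iff[OF wf] inner_diff_right)
      \<comment> \<open>This is the reflection of \<open>x\<close> in \<open>xs\<close>. As both
        points are feasible, a normal vector has inner product at most 0 with \<open>x - xs\<close>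
        and with its negative, so it is orthogonal to it. No representation of normal vectors by the
        active constraint normals is required.\<close>
      have refl: "xs - (x - xs) \<in> Omega C"
        using x perp by (intro face) (auto simp: norm_minus_commute inner_diff_right)
      have opp: "v \<bullet> (x - xs) = 0" if "v \<in> normal_cone (Omega C) xs" for v
      proof -
        have "v \<bullet> (xs - (x - xs) - xs) \<le> 0" "v \<bullet> (x - xs) \<le> 0"
          using that refl xO unfolding normal_cone_def by blast+
        then show ?thesis by (simp add: inner_diff_right)
      qed
      have "normal_cone (Omega C) xs \<subseteq> {s. (x - xs) \<bullet> s = 0}"
        using opp by (auto simp: inner_commute)
      then have "normal_space \<subseteq> {s. (x - xs) \<bullet> s = 0}"
        by (rule span_minimal) (rule subspace_hyperplane)
      then show "normal_part (x - xs) = 0"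
        by (intro normal_part_eqI) (auto intro: span_zero)
    next
      assume 0: "normal_part (x - xs) = 0"
      show "active C xs \<subseteq> active C x"
      proof (rule subrelI)
        fix k i assume ki: "(k, i) \<in> active C xs"
        then have "con_normal C k i \<bullet> (x - xs) = 0"
          using inner_normal_part[of "con_normal C k i" "x - xs"] active_normal_in[OF ki] span_base 0
          by fastforce
        then show "(k, i) \<in> active C x"
          using ki by (simp add: mem_active_iff[OF wf] inner_diff_right)
      qed
    qed
  qed
qed

text \<open>A normal vector is at an obtuse or right angle to every tangent direction, so its
  projection onto the tangent cone, tested against \<open>0\<close>, satisfies
  \<open>?p \<bullet> ?p \<le> 0\<close>.\<close>

lemma proj_grad_eq_0:
  assumes "- grad L xs \<in> normal_cone (Omega C) xs"
  shows "proj_grad (Omega C) L xs = 0"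
proof -
  let ?T = "tangent_cone (Omega C) xs"
  note T = tangent_cone_Omega_closed_convex[OF wf xs_in]
  have "{d. \<exists>t>0. \<forall>s\<in>{0..t}. xs + s *\<^sub>R d \<in> Omega C} \<subseteq> {d. - grad L xs \<bullet> d \<le> 0}"
  proof
    fix d assume "d \<in> {d. \<exists>t>0. \<forall>s\<in>{0..t}. xs + s *\<^sub>R d \<in> Omega C}"
    then obtain t where t: "t > 0" "xs + t *\<^sub>R d \<in> Omega C" by force
    have "- grad L xs \<bullet> (xs + t *\<^sub>R d - xs) \<le> 0"
      using assms t(2) unfolding normal_cone_def by blast
    then show "d \<in> {d. - grad L xs \<bullet> d \<le> 0}"
      using t(1) by (simp add: zero_le_mult_iff)
  qed
  then have sub: "?T \<subseteq> {d. - grad L xs \<bullet> d \<le> 0}"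
    unfolding tangent_cone_def by (rule closure_minimal) (rule closed_halfspace_le)
  let ?p = "closest_point ?T (- grad L xs)"
  have p: "?p \<in> ?T" using T by (intro closest_point_in_set) auto
  have "(- grad L xs - ?p) \<bullet> (0 - ?p) \<le> 0" using T by (intro closest_point_dot) auto
  moreover have "- grad L xs \<bullet> ?p \<le> 0" using p sub by blast
  ultimately have "?p \<bullet> ?p \<le> 0" by (simp add: inner_diff_left inner_diff_right)
  then have "?p = 0" by (metis inner_eq_zero_iff inner_ge_zero order_antisym)
  then show ?thesis unfolding proj_grad_def .
qed

end

section \<open>Growth of the objective around a nondegenerate point\<close>

locale nondegenerate_point = face_point C xs
  for C :: "('n::finite) block_constraints" and xs +
  fixes L :: "real ^ 'n \<Rightarrow> real"
  assumes nondegenerate: "nondegenerate (Omega C) L xs"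
begin

lemma neg_grad_in_normal_cone: "- grad L xs \<in> normal_cone (Omega C) xs"
  using nondegenerate rel_interior_subset unfolding nondegenerate_def by blast

lemma grad_in_normal_space: "grad L xs \<in> normal_space"
  using span_neg[OF span_base[OF neg_grad_in_normal_cone]] by simp

text \<open>Relative interiority leaves room \<open>e\<close> inside the cone:
  \<open>- grad L xs\<close>, moved by \<open>e\<close> in the direction of the normal part
  \<open>u\<close>, is still a normal vector. The inequality defining normality of this moved
  vector, tested at \<open>x\<close>, is the claim.\<close>

lemma grad_linear_growth:
  obtains \<epsilon> where "0 < \<epsilon>"
    "\<And>x. x \<in> Omega C \<Longrightarrow> \<epsilon> * norm (normal_part (x - xs)) \<le> grad L xs \<bullet> normal_part (x - xs)"
proof -
  let ?N = "normal_cone (Omega C) xs"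
  have "0 \<in> ?N" by (simp add: normal_cone_def)
  then have "affine hull ?N = normal_space" by (intro affine_hull_span_0 hull_inc)
  then obtain e where e: "e > 0" "cball (- grad L xs) e \<inter> normal_space \<subseteq> ?N"
    using nondegenerate unfolding nondegenerate_def mem_rel_interior_cball by auto
  show ?thesis
  proof (rule that[OF \<open>e > 0\<close>])
    fix x assume x: "x \<in> Omega C"
    define u where "u = normal_part (x - xs)"
    show "e * norm (normal_part (x - xs)) \<le> grad L xs \<bullet> normal_part (x - xs)"
    proof (cases "u = 0")
      case True
      then show ?thesis unfolding u_def by simp
    next
      case False
      define v where "v = - grad L xs + (e / norm u) *\<^sub>R u"
      have "v \<in> normal_space" unfolding v_def u_def
        by (intro span_add span_mul normal_part_in span_base neg_grad_in_normal_cone)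
      moreover have "v \<in> cball (- grad L xs) e"
        using False \<open>e > 0\<close> unfolding v_def by (simp add: dist_norm)
      ultimately have "v \<in> ?N" and S: "v \<in> normal_space" using e by auto
      then have "v \<bullet> (x - xs) \<le> 0" using x unfolding normal_cone_def by blast
      then have "v \<bullet> u \<le> 0" unfolding u_def inner_normal_part[OF S] .
      then have "(e / norm u) * (u \<bullet> u) \<le> grad L xs \<bullet> u"
        unfolding v_def by (simp add: inner_add_left inner_diff_left)
      moreover have "(e / norm u) * (u \<bullet> u) = e * norm u"
        using False by (simp add: power2_norm_eq_inner[symmetric] power2_eq_square)
      ultimately show ?thesis unfolding u_def by simp
    qed
  qed
qed

lemma block_linear_growth:
  assumes "\<And>x. x \<in> Omega C \<Longrightarrow> \<epsilon> * norm (normal_part (x - xs)) \<le> grad L xs \<bullet> normal_part (x - xs)"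
    and "x \<in> Omega C"
  shows "\<epsilon> * norm (block C k (normal_part (x - xs))) \<le> grad L xs \<bullet> block C k (normal_part (x - xs))"
  using assms(1)[OF Omega_replace_block[OF wf xs_in \<open>x \<in> Omega C\<close>, of k]]
  by (simp add: normal_part_block)

text \<open>Along the normal space \<open>L\<close> grows linearly by nondegeneracy, along its complement quadratically;
  the mixed terms are dominated by the linear growth.\<close>

lemma quadratic_growth:
  assumes "\<And>w. w \<in> Omega C \<Longrightarrow> L differentiable (at w)" "grad L differentiable (at xs)"
    and "0 < \<kappa>"
    and "\<And>v. v \<in> orthogonal_comp (normal_cone (Omega C) xs) \<Longrightarrow>
         v \<bullet> (hessian L xs *v v) \<ge> \<kappa> * (norm v)\<^sup>2"
  obtains \<delta> where "0 < \<delta>"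
    "\<And>x. x \<in> Omega C \<Longrightarrow> norm (x - xs) < \<delta> \<Longrightarrow> L xs + \<kappa> / 4 * (norm (x - xs))\<^sup>2 \<le> L x"
proof -
  define H where "H = hessian L xs"
  obtain h where h: "0 < h" "\<And>v. norm (H *v v) \<le> norm v * h"
    using bounded_linear.pos_bounded[OF matrix_vector_mul_bounded_linear] by metis
  obtain \<epsilon> where \<epsilon>: "0 < \<epsilon>"
    "\<And>x. x \<in> Omega C \<Longrightarrow> \<epsilon> * norm (normal_part (x - xs)) \<le> grad L xs \<bullet> normal_part (x - xs)"
    using grad_linear_growth by blast
  \<comment> \<open>The curvature contributes \<open>\<kappa> / 2\<close>; half of it is spent on
    the Taylor remainder, which leaves the \<open>\<kappa> / 4\<close> of the conclusion.\<close>
  have "0 < \<kappa> / 4" using assms(3) by simp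
  then obtain \<delta> where \<delta>: "0 < \<delta>"
    "\<And>y. y \<in> Omega C \<Longrightarrow> norm (y - xs) < \<delta> \<Longrightarrow>
       \<bar>L y - L xs - grad L xs \<bullet> (y - xs) - (y - xs) \<bullet> (H *v (y - xs)) / 2\<bar>
         \<le> \<kappa> / 4 * (norm (y - xs))\<^sup>2"
    using second_order_remainder[OF convex_Omega[OF wf] xs_in assms(1,2)] unfolding H_def by metis
  \<comment> \<open>Within this radius the mixed terms, at most
    \<open>norm d * norm a * (h + \<kappa> / 2)\<close> in half the quadratic form, are absorbed by
    the linear growth \<open>\<epsilon> * norm a\<close>.\<close>
  define \<delta>' where "\<delta>' = min \<delta> (\<epsilon> / (h + \<kappa>))"
  have pos: "0 < h + \<kappa>" using h assms(3) by simp
  show ?thesis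
  proof (rule that)
    show "0 < \<delta>'" using \<delta>(1) \<epsilon>(1) pos unfolding \<delta>'_def by simp
  next
    fix x assume x: "x \<in> Omega C" "norm (x - xs) < \<delta>'"
    define d where "d = x - xs"
    define a where "a = normal_part d"
    define v where "v = d - a"
    have d: "norm d < \<delta>" "norm d * (h + \<kappa>) \<le> \<epsilon>"
      using x(2) pos unfolding d_def \<delta>'_def by (auto simp: pos_less_divide_eq)
    have a: "norm a \<le> norm d" and v: "norm v \<le> norm d"
      unfolding a_def v_def using norm_normal_part_le norm_tangential_part_le by auto
    have "v \<bullet> (H *v v) \<ge> \<kappa> * (norm v)\<^sup>2"
      unfolding v_def a_def H_def by (intro assms(4) tangential_part_in)
    moreover have "(norm v)\<^sup>2 = (norm d)\<^sup>2 - (norm a)\<^sup>2"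
      using norm_sq_normal_part[of d] unfolding v_def a_def by simp
    moreover have aa: "(norm a)\<^sup>2 \<le> norm d * norm a"
      using a by (simp add: power2_eq_square mult_right_mono)
    then have "\<kappa> * (norm a)\<^sup>2 \<le> \<kappa> * (norm d * norm a)"
      using assms(3) by (intro mult_left_mono) auto
    ultimately have vHv: "\<kappa> * (norm d)\<^sup>2 - \<kappa> * (norm d * norm a) \<le> v \<bullet> (H *v v)"
      by (simp add: right_diff_distrib)
    have cross: "\<bar>u \<bullet> (H *v w)\<bar> \<le> norm u * norm w * h" for u w
    proof -
      have "norm u * norm (H *v w) \<le> norm u * (norm w * h)"
        using h by (intro mult_left_mono) auto
      then show ?thesis
        using Cauchy_Schwarz_ineq2[of u "H *v w"] by (simp add: mult.assoc)
    qed
    have "\<bar>a \<bullet> (H *v d)\<bar> \<le> norm d * norm a * h" using cross[of a d] by (simp add: mult.commute)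
    moreover have "\<bar>v \<bullet> (H *v a)\<bar> \<le> norm d * norm a * h"
      using cross[of v a] v h(1) by (smt (verit) mult_right_mono norm_ge_zero)
    moreover have "d \<bullet> (H *v d) = v \<bullet> (H *v v) + v \<bullet> (H *v a) + a \<bullet> (H *v d)"
      unfolding v_def by (simp add: matrix_vector_mult_diff_distrib inner_diff_left inner_diff_right)
    ultimately have dHd: "\<kappa> * (norm d)\<^sup>2 - \<kappa> * (norm d * norm a) - 2 * (norm d * norm a * h) \<le> d \<bullet> (H *v d)"
      using vHv by linarith
    have "norm d * (h + \<kappa>) * norm a \<le> \<epsilon> * norm a"
      using d(2) by (rule mult_right_mono) simp
    moreover have "\<epsilon> * norm a \<le> grad L xs \<bullet> d"
      using \<epsilon>(2)[OF x(1)] inner_normal_part[OF grad_in_normal_space] unfolding a_def d_def by simp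
    moreover have "\<bar>L x - L xs - grad L xs \<bullet> d - d \<bullet> (H *v d) / 2\<bar> \<le> \<kappa> / 4 * (norm d)\<^sup>2"
      using \<delta>(2)[OF x(1)] d(1) unfolding d_def by blast
    moreover have "norm d * (h + \<kappa>) * norm a = norm d * norm a * h + \<kappa> * (norm d * norm a)"
      by (simp add: algebra_simps)
    moreover have "0 \<le> \<kappa> * (norm d * norm a)" using assms(3) by simp
    ultimately have "L xs + \<kappa> * (norm d)\<^sup>2 / 2 - \<kappa> / 4 * (norm d)\<^sup>2 \<le> L x"
      using dHd by linarith
    then show "L xs + \<kappa> / 4 * (norm (x - xs))\<^sup>2 \<le> L x"
      unfolding d_def by (simp add: algebra_simps)
  qed
qed

end

section \<open>One iteration of the algorithm\<close>

lemma model_self [simp]: "model L B x x = L x"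
  by (simp add: model_def)

lemma symmetric_matrix_inner:
  fixes A :: "real ^ 'n ^ 'n"
  assumes "transpose A = A"
  shows "u \<bullet> (A *v v) = (A *v u) \<bullet> v"
  using assms by (metis dot_lmul_matrix transpose_matrix_vector)

lemma model_add:
  fixes L :: "real ^ 'n \<Rightarrow> real"
  assumes "transpose (B x) = B x"
  shows "model L B x (w + d) =
    model L B x w + (grad L x + B x *v (w - x)) \<bullet> d + 1 / 2 * (d \<bullet> (B x *v d))"
proof -
  have "w + d - x = (w - x) + d" by simp
  moreover have "(w - x) \<bullet> (B x *v d) = d \<bullet> (B x *v (w - x))"
    using symmetric_matrix_inner[OF assms] by (simp add: inner_commute)
  ultimately show ?thesis
    unfolding model_def
    by (simp only: inner_add_right inner_add_left matrix_vector_right_distrib)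
      (simp add: inner_commute algebra_simps)
qed

lemma abs_quadratic_le:
  fixes A :: "real ^ 'n ^ 'n"
  assumes "onorm ((*v) A) \<le> b"
  shows "\<bar>d \<bullet> (A *v d)\<bar> \<le> b * (norm d)\<^sup>2"
proof -
  have "norm (A *v d) \<le> onorm ((*v) A) * norm d"
    by (rule onorm) (rule matrix_vector_mul_bounded_linear)
  also have "\<dots> \<le> b * norm d" using assms by (rule mult_right_mono) simp
  finally have "norm d * norm (A *v d) \<le> norm d * (b * norm d)"
    by (rule mult_left_mono) simp
  then show ?thesis
    using Cauchy_Schwarz_ineq2[of d "A *v d"] by (simp add: power2_eq_square algebra_simps)
qed

text \<open>State of the block sweep just before block \<open>k\<close> is treated. Since blocks are
  numbered from 1, it runs from \<open>x\<close> at index 1 to \<open>z\<close> at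
  \<open>Suc (num_blocks C)\<close>, so that model decreases telescope.\<close>

definition partial_step ::
  "('n::finite) block_constraints \<Rightarrow> real ^ 'n \<Rightarrow> real ^ 'n \<Rightarrow> nat \<Rightarrow> real ^ 'n" where
  "partial_step C x z k = (\<chi> j. if block_of C j < k then z $ j else x $ j)"

definition partial_grad ::
  "('n::finite) block_constraints \<Rightarrow> (real ^ 'n \<Rightarrow> real) \<Rightarrow> (real ^ 'n \<Rightarrow> real ^ 'n ^ 'n) \<Rightarrow>
   real ^ 'n \<Rightarrow> real ^ 'n \<Rightarrow> nat \<Rightarrow> real ^ 'n" where
  "partial_grad C L B x z k = block C k (grad L x + B x *v (partial_step C x z k - x))"

lemma partial_step_first:
  assumes "wf_constraints C"
  shows "partial_step C x z 1 = x"
proof -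
  have *: "block_of C j \<noteq> 0" for j
    using assms unfolding wf_constraints_def by (metis atLeastAtMost_iff not_one_le_zero)
  show ?thesis by (simp add: * partial_step_def vec_eq_iff)
qed

lemma partial_step_last: "wf_constraints C \<Longrightarrow> partial_step C x z (Suc (num_blocks C)) = z"
  by (auto simp: partial_step_def wf_constraints_def vec_eq_iff less_Suc_eq_le)

lemma norm_partial_step_diff_le: "norm (partial_step C x z k - x) \<le> norm (z - x)"
  by (rule norm_le_componentwise_cart) (auto simp: partial_step_def)

lemma inner_partial_grad:
  "u \<in> block_space C k \<Longrightarrow>
    partial_grad C L B x z k \<bullet> u = (grad L x + B x *v (partial_step C x z k - x)) \<bullet> u"
  unfolding partial_grad_def by (simp add: inner_block_left block_block_space)

text \<open>The blocks moved earlier in the sweep change the gradient by \<open>B x\<close> applied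
  to a part of the step \<open>z - x\<close>. The reference \<open>g\<close> will be the gradient at
  \<open>xs\<close>.\<close>

lemma norm_partial_grad_diff_le:
  assumes "onorm ((*v) (B x)) \<le> b"
  shows "norm (partial_grad C L B x z k - block C k g) \<le> norm (grad L x - g) + b * norm (z - x)"
proof -
  let ?s = "partial_step C x z k - x"
  have "norm (partial_grad C L B x z k - block C k g) \<le> norm ((grad L x - g) + B x *v ?s)"
    unfolding partial_grad_def block_diff[symmetric]
    using norm_block_le[of C k "(grad L x - g) + B x *v ?s"] by (simp add: algebra_simps)
  also have "\<dots> \<le> norm (grad L x - g) + norm (B x *v ?s)" by (rule norm_triangle_ineq)
  also have "norm (B x *v ?s) \<le> onorm ((*v) (B x)) * norm ?s"
    by (rule onorm) (rule matrix_vector_mul_bounded_linear)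
  also have "\<dots> \<le> b * norm (z - x)"
  proof (rule mult_mono[OF assms norm_partial_step_diff_le])
    show "0 \<le> b"
      using onorm_pos_le[OF matrix_vector_mul_bounded_linear[of "B x"]] assms by (rule order_trans)
  qed simp
  finally show ?thesis by simp
qed

text \<open>The block model ignores coordinates of \<open>u\<close> outside block \<open>k\<close>.
  In the quadratic term this needs \<open>block C k u\<close>; in the linear term
  \<open>partial_grad\<close> already removes them.\<close>

lemma block_model_expand:
  assumes "transpose (B x) = B x"
  shows "block_model C L B x z k u = model L B x (partial_step C x z k)
    + partial_grad C L B x z k \<bullet> (u - block C k x)
    + 1 / 2 * ((block C k u - block C k x) \<bullet> (B x *v (block C k u - block C k x)))"
proof -
  let ?d = "block C k u - block C k x"
  have "block_model C L B x z k u = model L B x (partial_step C x z k + ?d)"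
    unfolding block_model_def
    by (rule arg_cong[where f = "model L B x"]) (auto simp: partial_step_def block_def vec_eq_iff)
  also have "\<dots> = model L B x (partial_step C x z k)
      + partial_grad C L B x z k \<bullet> ?d + 1 / 2 * (?d \<bullet> (B x *v ?d))"
    unfolding model_add[of B x, OF assms]
    by (subst inner_partial_grad) (auto simp: subspace_diff[OF subspace_block_space])
  also have "partial_grad C L B x z k \<bullet> ?d = partial_grad C L B x z k \<bullet> (u - block C k x)"
    unfolding partial_grad_def by (simp add: inner_block_left block_diff)
  finally show ?thesis .
qed

lemma grad_block_model:
  assumes "transpose (B x) = B x"
  shows "grad (block_model C L B x z k) (block C k x) = partial_grad C L B x z k"
proof (rule grad_eqI)
  let ?G = "partial_grad C L B x z k"
  have b: "bounded_linear (block C k)" using linear_block linear_conv_bounded_linear by blast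
  have 1: "((\<lambda>u. block C k u - block C k x) has_derivative (\<lambda>h. block C k h)) (at (block C k x))"
    using has_derivative_diff[OF bounded_linear_imp_has_derivative[OF b] has_derivative_const] by simp
  \<comment> \<open>Both factors vanish at the base point, so the product has derivative zero
    there.\<close>
  have 2: "((\<lambda>u. (block C k u - block C k x) \<bullet> (B x *v (block C k u - block C k x)))
      has_derivative (\<lambda>h. 0)) (at (block C k x))"
    using has_derivative_inner[OF 1
        bounded_linear.has_derivative[OF matrix_vector_mul_bounded_linear[of "B x"] 1]]
    by simp
  have 3: "((\<lambda>u. model L B x (partial_step C x z k) + ?G \<bullet> (u - block C k x))
      has_derivative (\<lambda>h. h \<bullet> ?G)) (at (block C k x))"
    by (auto intro!: derivative_eq_intros simp: inner_commute)
  have "((\<lambda>u. model L B x (partial_step C x z k) + ?G \<bullet> (u - block C k x)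
      + 1 / 2 * ((block C k u - block C k x) \<bullet> (B x *v (block C k u - block C k x))))
      has_derivative (\<lambda>h. h \<bullet> ?G)) (at (block C k x))"
    using has_derivative_add[OF 3 has_derivative_mult_right[OF 2, of "1 / 2"]] by simp
  then show "GDERIV (block_model C L B x z k) (block C k x) :> ?G"
    unfolding gderiv_def block_model_expand[of B x, OF assms, symmetric] by simp
qed

section \<open>Feasibility, step lengths and decrease of the Cauchy point\<close>

lemma cauchy_point_in_Omega:
  assumes "\<And>k. k \<in> {1..num_blocks C} \<Longrightarrow> Omega_block C k \<noteq> {}"
    and "cauchy_point p C L B x \<Delta> z"
  shows "z \<in> Omega C"
  unfolding Omega_def
proof (intro CollectI ballI)
  fix k assume k: "k \<in> {1..num_blocks C}"
  then obtain \<alpha> where "block C k z = block_step C L B x z k \<alpha>"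
    using assms(2) unfolding cauchy_point_def Let_def by blast
  then show "block C k z \<in> Omega_block C k"
    unfolding block_step_def
    using closest_point_in_set[OF closed_Omega_block assms(1)[OF k]] by simp
qed

text \<open>The three lower bounds on the step length come from the three alternatives of the step-size rule:
  no trial step failed, a trial step violated the sufficient decrease condition (so it was not
  small compared with the curvature), or a trial step reached the trust region boundary.\<close>

lemma cauchy_point_block:
  assumes "valid_params p" "x \<in> Omega C" "transpose (B x) = B x"
    and "0 < b" "onorm ((*v) (B x)) \<le> b"
    and "cauchy_point p C L B x \<Delta> z" "k \<in> {1..num_blocks C}"
  obtains \<alpha> where "0 < \<alpha>" "\<alpha> \<le> nu5 p"
    "block C k z = closest_point (Omega_block C k) (block C k x - \<alpha> *\<^sub>R partial_grad C L B x z k)"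
    "model L B x (partial_step C x z (Suc k)) \<le> model L B x (partial_step C x z k)
       + nu0 p * (partial_grad C L B x z k \<bullet> (block C k z - block C k x))"
    "infnorm (block C k z - block C k x) \<le> nu2 p * \<Delta>"
    "nu4 p \<le> \<alpha> \<or> nu3 p * (2 * (1 - nu0 p) / b) \<le> \<alpha> \<or>
     nu3 p * nu1 p * \<Delta> \<le> \<alpha> * norm (partial_grad C L B x z k)"
proof -
  let ?G = "partial_grad C L B x z k"
  let ?m = "block_model C L B x z k"
  let ?x = "block C k x"
  note sym = assms(3)
  note grad = grad_block_model[of B x C L z k, OF sym]
  note p = assms(1)[unfolded valid_params_def]
  have step: "block_step C L B x z k \<alpha> = closest_point (Omega_block C k) (?x - \<alpha> *\<^sub>R ?G)" for \<alpha>
    unfolding block_step_def grad ..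
  have xk: "?x \<in> Omega_block C k" using assms(2,7) by (simp add: Omega_def)
  have mx: "?m ?x = model L B x (partial_step C x z k)"
    by (simp add: block_model_expand[of B x, OF sym])
  have mz: "?m (block C k z) = model L B x (partial_step C x z (Suc k))"
    unfolding block_model_def
    by (rule arg_cong[where f = "model L B x"]) (auto simp: partial_step_def block_def vec_eq_iff)
  obtain \<alpha> where \<alpha>: "0 < \<alpha>" "block C k z = block_step C L B x z k \<alpha>"
    "?m (block C k z) \<le> ?m ?x + nu0 p * (?G \<bullet> (block C k z - ?x))"
    "infnorm (block C k z - ?x) \<le> nu2 p * \<Delta>"
    "\<alpha> \<in> {nu4 p..nu5 p} \<or>
            (\<exists>\<alpha>'>0. \<alpha> \<in> {nu3 p * \<alpha>'..nu5 p} \<and>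
               (?m (block_step C L B x z k \<alpha>') > ?m ?x + nu0 p * (?G \<bullet> (block_step C L B x z k \<alpha>' - ?x)) \<or>
                infnorm (block_step C L B x z k \<alpha>' - ?x) \<ge> nu1 p * \<Delta>))"
    using bspec[OF assms(6)[unfolded cauchy_point_def Let_def] assms(7), unfolded grad] by blast
  have lower: "nu4 p \<le> \<alpha> \<or> nu3 p * (2 * (1 - nu0 p) / b) \<le> \<alpha> \<or> nu3 p * nu1 p * \<Delta> \<le> \<alpha> * norm ?G"
  proof (cases "nu4 p \<le> \<alpha>")
    case False
    then obtain \<alpha>' where \<alpha>': "0 < \<alpha>'" "nu3 p * \<alpha>' \<le> \<alpha>"
      "?m (block_step C L B x z k \<alpha>') > ?m ?x + nu0 p * (?G \<bullet> (block_step C L B x z k \<alpha>' - ?x)) \<or>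
       infnorm (block_step C L B x z k \<alpha>' - ?x) \<ge> nu1 p * \<Delta>"
      using \<alpha>(5) by auto
    define s where "s = block_step C L B x z k \<alpha>' - ?x"
    have s1: "(norm s)\<^sup>2 \<le> \<alpha>' * - (?G \<bullet> s)"
      unfolding s_def by (rule projected_step_descent[OF convex_Omega_block closed_Omega_block xk step])
    have s2: "norm s \<le> \<alpha>' * norm ?G"
      unfolding s_def
      by (rule projected_step_length[OF convex_Omega_block closed_Omega_block xk step \<alpha>'(1)])
    from \<alpha>'(3) show ?thesis
    proof
      assume viol: "?m (block_step C L B x z k \<alpha>') > ?m ?x + nu0 p * (?G \<bullet> (block_step C L B x z k \<alpha>' - ?x))"
      have "block_step C L B x z k \<alpha>' \<in> Omega_block C k"
        unfolding step using xk closed_Omega_block by (intro closest_point_in_set) auto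
      then have "block C k (block_step C L B x z k \<alpha>') = block_step C L B x z k \<alpha>'"
        by (simp add: Omega_block_def block_block_space)
      then have "?m (block_step C L B x z k \<alpha>') = ?m ?x + ?G \<bullet> s + 1 / 2 * (s \<bullet> (B x *v s))"
        unfolding mx s_def by (simp add: block_model_expand[of B x, OF sym])
      \<comment> \<open>The failed condition bounds \<open>- (?G \<bullet> s)\<close> by the
        curvature term, and \<open>s1\<close> bounds the curvature term by \<alpha>' times the same
        quantity. Cancelling it leaves a lower bound on \<alpha>'.\<close>
      with viol have "(1 - nu0 p) * - (?G \<bullet> s) < 1 / 2 * (s \<bullet> (B x *v s))"
        unfolding s_def[symmetric] by (simp add: algebra_simps)
      also have "\<dots> \<le> 1 / 2 * (b * (norm s)\<^sup>2)"
        using abs_quadratic_le[OF assms(5), of s] by simp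
      also have "\<dots> \<le> 1 / 2 * (b * (\<alpha>' * - (?G \<bullet> s)))"
        using s1 \<open>0 < b\<close> by (intro mult_left_mono) auto
      finally have lt: "(1 - nu0 p) * - (?G \<bullet> s) < (b * \<alpha>' / 2) * - (?G \<bullet> s)"
        by (simp add: algebra_simps)
      have "0 \<le> \<alpha>' * - (?G \<bullet> s)" using s1 zero_le_power2 order_trans by blast
      then have "0 \<le> - (?G \<bullet> s)" using \<alpha>'(1) by (simp add: mult_le_0_iff)
      with lt have "1 - nu0 p < b * \<alpha>' / 2"
        by (meson linorder_not_less mult_right_mono)
      then have "2 * (1 - nu0 p) / b \<le> \<alpha>'"
        using \<open>0 < b\<close> by (simp add: pos_divide_le_eq mult.commute)
      then have "nu3 p * (2 * (1 - nu0 p) / b) \<le> nu3 p * \<alpha>'"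
        using p by (intro mult_left_mono) auto
      then show ?thesis using \<alpha>'(2) by linarith
    next
      assume "nu1 p * \<Delta> \<le> infnorm (block_step C L B x z k \<alpha>' - ?x)"
      then have "nu1 p * \<Delta> \<le> \<alpha>' * norm ?G"
        using s2 infnorm_le_norm[of s] unfolding s_def by linarith
      then have "nu3 p * (nu1 p * \<Delta>) \<le> nu3 p * (\<alpha>' * norm ?G)"
        using p by (intro mult_left_mono) auto
      also have "\<dots> = (nu3 p * \<alpha>') * norm ?G" by simp
      also have "\<dots> \<le> \<alpha> * norm ?G" using \<alpha>'(2) by (rule mult_right_mono) simp
      finally show ?thesis by (simp add: mult.assoc)
    qed
  qed simp
  show ?thesis
  proof (rule that[OF \<alpha>(1) _ _ _ \<alpha>(4) lower])
    show "\<alpha> \<le> nu5 p" using \<alpha>(5) by auto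
    show "block C k z = closest_point (Omega_block C k) (?x - \<alpha> *\<^sub>R ?G)"
      using \<alpha>(2) unfolding step .
    show "model L B x (partial_step C x z (Suc k)) \<le> model L B x (partial_step C x z k)
       + nu0 p * (?G \<bullet> (block C k z - ?x))"
      using \<alpha>(3) unfolding mx mz .
  qed
qed

text \<open>The block conditions telescope along the sweep. The cap \<open>nu5 p\<close> on step
  lengths then turns first-order decrease into squared step length.\<close>

lemma cauchy_decrease:
  assumes "wf_constraints C" "valid_params p" "x \<in> Omega C" "transpose (B x) = B x"
    and "0 < b" "onorm ((*v) (B x)) \<le> b" "cauchy_point p C L B x \<Delta> z"
  shows "nu0 p * (\<Sum>k\<in>{1..num_blocks C}. - (partial_grad C L B x z k \<bullet> (block C k z - block C k x)))
      \<le> L x - model L B x z" (is "nu0 p * (\<Sum>k\<in>?K. ?e k) \<le> _")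
    and "\<And>k. k \<in> {1..num_blocks C} \<Longrightarrow>
      (norm (block C k z - block C k x))\<^sup>2 / nu5 p
        \<le> - (partial_grad C L B x z k \<bullet> (block C k z - block C k x))"
    and "nu0 p / nu5 p * (norm (z - x))\<^sup>2 \<le> L x - model L B x z"
proof -
  let ?f = "\<lambda>k. model L B x (partial_step C x z k)"
  note p = assms(2)[unfolded valid_params_def]
  have "nu0 p * ?e k \<le> ?f k - ?f (Suc k)" if k: "k \<in> ?K" for k
  proof (rule cauchy_point_block[OF assms(2-7) k])
    assume "?f (Suc k) \<le> ?f k + nu0 p * (partial_grad C L B x z k \<bullet> (block C k z - block C k x))"
    then show ?thesis by simp
  qed
  then have "(\<Sum>k\<in>?K. nu0 p * ?e k) \<le> (\<Sum>k\<in>?K. ?f k - ?f (Suc k))"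
    by (rule sum_mono)
  also have "\<dots> = - (\<Sum>k\<in>?K. ?f (Suc k) - ?f k)" by (simp add: sum_negf[symmetric])
  also have "\<dots> = L x - model L B x z"
    by (subst sum_Suc_diff) (auto simp: partial_step_last[OF assms(1)] partial_step_first[OF assms(1), simplified])
  finally show 1: "nu0 p * (\<Sum>k\<in>?K. ?e k) \<le> L x - model L B x z" by (simp add: sum_distrib_left)
  show 2: "(norm (block C k z - block C k x))\<^sup>2 / nu5 p \<le> ?e k" if k: "k \<in> ?K" for k
  proof -
    obtain \<alpha> where \<alpha>: "0 < \<alpha>" "\<alpha> \<le> nu5 p"
      "block C k z = closest_point (Omega_block C k) (block C k x - \<alpha> *\<^sub>R partial_grad C L B x z k)"
      by (rule cauchy_point_block[OF assms(2-7) k]) (rule that; assumption)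
    have xk: "block C k x \<in> Omega_block C k" using assms(3) k by (simp add: Omega_def)
    have *: "(norm (block C k z - block C k x))\<^sup>2 \<le> \<alpha> * ?e k"
      by (rule projected_step_descent[OF convex_Omega_block closed_Omega_block xk \<alpha>(3)])
    then have "0 \<le> \<alpha> * ?e k" using zero_le_power2 order_trans by blast
    then have "0 \<le> ?e k" using \<alpha>(1) by (simp add: mult_le_0_iff)
    then have "\<alpha> * ?e k \<le> nu5 p * ?e k" using \<alpha>(2) by (rule mult_right_mono[rotated])
    with * have "(norm (block C k z - block C k x))\<^sup>2 \<le> ?e k * nu5 p" by (simp add: mult.commute)
    then show ?thesis using p by (simp add: pos_divide_le_eq)
  qed
  have "(norm (z - x))\<^sup>2 / nu5 p = (\<Sum>k\<in>?K. (norm (block C k z - block C k x))\<^sup>2 / nu5 p)"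
    unfolding norm_sq_blocks[OF assms(1), of "z - x"] block_diff sum_divide_distrib ..
  also have "\<dots> \<le> (\<Sum>k\<in>?K. ?e k)" using 2 by (rule sum_mono)
  finally have "nu0 p * ((norm (z - x))\<^sup>2 / nu5 p) \<le> nu0 p * (\<Sum>k\<in>?K. ?e k)"
    using p by (intro mult_left_mono) auto
  with 1 show "nu0 p / nu5 p * (norm (z - x))\<^sup>2 \<le> L x - model L B x z" by simp
qed

section \<open>Projected block steps near a nondegenerate point\<close>

context nondegenerate_point
begin

text \<open>A gradient error of \<open>\<epsilon> / 2\<close> costs half of the linear
  growth.\<close>

lemma inner_perturbed_gradient:
  assumes growth: "\<And>x. x \<in> Omega C \<Longrightarrow>
      \<epsilon> * norm (normal_part (x - xs)) \<le> grad L xs \<bullet> normal_part (x - xs)"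
    and "x \<in> Omega C" "norm (G - block C k (grad L xs)) \<le> \<epsilon> / 2"
  defines "q \<equiv> block C k (normal_part (x - xs))"
  shows "\<epsilon> / 2 * norm q \<le> G \<bullet> q"
proof -
  have "block C k (grad L xs) \<bullet> q = grad L xs \<bullet> q"
    unfolding q_def by (simp add: inner_block_left)
  then have "\<epsilon> * norm q \<le> block C k (grad L xs) \<bullet> q"
    using block_linear_growth[OF growth assms(2)] unfolding q_def by simp
  moreover have "\<bar>(G - block C k (grad L xs)) \<bullet> q\<bar> \<le> \<epsilon> / 2 * norm q"
    using Cauchy_Schwarz_ineq2 mult_right_mono[OF assms(3) norm_ge_zero] by (rule order_trans)
  ultimately show ?thesis unfolding inner_diff_left by linarith
qed

text \<open>A step that does not reach the face of \<open>xs\<close> is short, since \<open>G\<close> is close to \<open>grad L xs\<close>, which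
  pushes towards the face: test the projection with the point of the face next to \<open>z\<close>.\<close>

lemma projected_step_off_face:
  assumes growth: "\<And>x. x \<in> Omega C \<Longrightarrow>
      \<epsilon> * norm (normal_part (x - xs)) \<le> grad L xs \<bullet> normal_part (x - xs)"
    and z: "z \<in> Omega C" "z - normal_part (z - xs) \<in> Omega C" and k: "k \<in> {1..num_blocks C}"
    and G: "norm (G - block C k (grad L xs)) \<le> \<epsilon> / 2"
    and step: "block C k z = closest_point (Omega_block C k) (block C k x - \<alpha> *\<^sub>R G)" "0 < \<alpha>"
    and off: "block C k (normal_part (z - xs)) \<noteq> 0"
  shows "\<epsilon> * \<alpha> \<le> 2 * norm (normal_part (x - xs))"
proof -
  define q where "q = block C k (normal_part (z - xs))"
  define d where "d = normal_part (x - xs)"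
  have qS: "q \<in> normal_space"
    unfolding q_def by (rule block_normal_space[OF normal_part_in])
  have "block C k (z - normal_part (z - xs)) \<in> Omega_block C k"
    using z(2) k by (simp add: Omega_def)
  then have "block C k z - q \<in> Omega_block C k" unfolding q_def block_diff .
  then have "(block C k x - \<alpha> *\<^sub>R G - block C k z) \<bullet> (block C k z - q - block C k z) \<le> 0"
    unfolding step(1)[symmetric]
    using closest_point_dot[OF convex_Omega_block closed_Omega_block, of "block C k z - q" C k "block C k x - \<alpha> *\<^sub>R G"]
    unfolding step(1)[symmetric] by blast
  then have 1: "\<alpha> * (G \<bullet> q) + (block C k z - block C k x) \<bullet> q \<le> 0"
    by (simp add: inner_diff_left algebra_simps)
  have "(block C k z - block C k x) \<bullet> q = ((z - xs) - (x - xs)) \<bullet> q"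
    unfolding q_def by (simp add: inner_diff_left inner_block_left)
  \<comment> \<open>As \<open>q\<close> lies in the normal space, only normal parts count. That of
    \<open>z\<close> contributes \<open>q \<bullet> q \<ge> 0\<close>, which is dropped below, so
    only the displacement of \<open>x\<close> remains.\<close>
  also have "\<dots> = q \<bullet> normal_part (z - xs) - q \<bullet> d"
    unfolding d_def inner_normal_part[OF qS] by (simp only: inner_diff_left inner_commute[of q])
  also have "q \<bullet> normal_part (z - xs) = q \<bullet> q"
    unfolding q_def by (simp add: inner_block_block)
  finally have "- (norm q * norm d) \<le> (block C k z - block C k x) \<bullet> q"
    using Cauchy_Schwarz_ineq2[of q d] inner_ge_zero[of q] by linarith
  with 1 have "\<alpha> * (G \<bullet> q) \<le> norm q * norm d" by linarith
  moreover have "\<alpha> * (\<epsilon> / 2 * norm q) \<le> \<alpha> * (G \<bullet> q)"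
    using inner_perturbed_gradient[OF growth z(1) G] step(2) unfolding q_def
    by (intro mult_left_mono) auto
  ultimately have "norm q * (\<epsilon> * \<alpha>) \<le> norm q * (2 * norm d)" by (simp add: algebra_simps)
  moreover have "0 < norm q" using off unfolding q_def by simp
  ultimately show ?thesis unfolding d_def using mult_le_cancel_left_pos by blast
qed

text \<open>The comparison displacement is the block of the normal part of \<open>x - xs\<close>:
  subtracting it keeps the block feasible and moves it onto the face.\<close>

lemma projected_step_decrease_off_face:
  assumes growth: "\<And>x. x \<in> Omega C \<Longrightarrow>
      \<epsilon> * norm (normal_part (x - xs)) \<le> grad L xs \<bullet> normal_part (x - xs)"
    and "0 < \<epsilon>" and x: "x \<in> Omega C" "x - normal_part (x - xs) \<in> Omega C"
    and k: "k \<in> {1..num_blocks C}"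
    and G: "norm (G - block C k (grad L xs)) \<le> \<epsilon> / 2"
    and step: "block C k z = closest_point (Omega_block C k) (block C k x - \<alpha> *\<^sub>R G)" "0 < \<alpha>"
  shows "\<epsilon> / 4 * min (norm (block C k (normal_part (x - xs)))) (\<epsilon> / 2 * \<alpha>)
    \<le> - (G \<bullet> (block C k z - block C k x))"
proof (rule projected_step_linear_decrease[OF convex_Omega_block closed_Omega_block _ step])
  show "block C k x \<in> Omega_block C k" using x(1) k by (simp add: Omega_def)
  have "block C k (x - normal_part (x - xs)) \<in> Omega_block C k"
    using x(2) k by (simp add: Omega_def)
  then show "block C k x - block C k (normal_part (x - xs)) \<in> Omega_block C k"
    unfolding block_diff .
qed (use inner_perturbed_gradient[OF growth x(1) G] \<open>0 < \<epsilon>\<close> in auto)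

end

section \<open>Convergence of the iterates\<close>

locale trap_run = nondegenerate_point C xs L
  for C :: "('n::finite) block_constraints" and xs L +
  fixes p :: trap_params and B :: "real ^ 'n \<Rightarrow> real ^ 'n ^ 'n"
    and x y z :: "nat \<Rightarrow> real ^ 'n" and \<Delta> :: "nat \<Rightarrow> real" and b \<kappa> :: real
  assumes nonempty: "\<And>k. k \<in> {1..num_blocks C} \<Longrightarrow> Omega_block C k \<noteq> {}"
    and params: "valid_params p"
    and start: "x 0 \<in> Omega C" "0 < \<Delta> 0"
    and symmetric: "\<And>w. w \<in> Omega C \<Longrightarrow> transpose (B w) = B w"
    and cauchy: "\<And>l. cauchy_point p C L B (x l) (\<Delta> l) (z l)"
    and refine: "\<And>l. refinement p C L B (x l) (\<Delta> l) (z l) (y l)"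
    and update: "\<And>l. trap_update p L B (x l) (\<Delta> l) (y l) (x (Suc l)) (\<Delta> (Suc l))"
    and noncritical: "\<And>l. \<not> critical_point (Omega C) L (x l)"
    and diff_L: "\<And>w. w \<in> Omega C \<Longrightarrow> L differentiable (at w)"
    and diff_grad: "grad L differentiable (at xs)"
    and b: "0 < b" "\<And>w. w \<in> Omega C \<Longrightarrow> onorm ((*v) (B w)) \<le> b"
    and limit_point: "\<exists>r. strict_mono r \<and> (x \<circ> r) \<longlonglongrightarrow> xs"
    and second_order: "0 < \<kappa>"
      "\<And>v. v \<in> orthogonal_comp (normal_cone (Omega C) xs) \<Longrightarrow>
         v \<bullet> (hessian L xs *v v) \<ge> \<kappa> * (norm v)\<^sup>2"
begin

lemmas p = params[unfolded valid_params_def]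

section \<open>Acceptance, radius update and guaranteed decrease\<close>

definition model_decrease :: "nat \<Rightarrow> real" where
  "model_decrease l = L (x l) - model L B (x l) (y l)"

text \<open>With zero model decrease the quotient is 0 by convention, so such an iteration counts as
  rejected and accepted ones have positive model decrease.\<close>

definition accepted :: "nat \<Rightarrow> bool" where
  "accepted l \<longleftrightarrow> eta1 p \<le> (L (x l) - L (y l)) / model_decrease l"

lemma y_in_Omega: "y l \<in> Omega C"
  using refine[of l] unfolding refinement_def by blast

lemma z_in_Omega: "z l \<in> Omega C"
  using cauchy_point_in_Omega[OF nonempty cauchy] by blast

lemma accepted_step:
  assumes "accepted l"
  shows "x (Suc l) = y l" "sigma1 p * \<Delta> l \<le> \<Delta> (Suc l)"
proof -
  define \<rho> where "\<rho> = (L (x l) - L (y l)) / model_decrease l"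
  note u = update[of l, unfolded trap_update_def model_self, folded model_decrease_def,
      unfolded Let_def, folded \<rho>_def]
  have "eta1 p \<le> \<rho>" using assms unfolding accepted_def \<rho>_def .
  then have "x (Suc l) = y l \<and> (\<Delta> (Suc l) \<in> {sigma1 p * \<Delta> l..sigma3 p * \<Delta> l} \<or> \<rho> > eta2 p)"
    using u by force
  moreover have "\<Delta> l \<le> \<Delta> (Suc l)" if "\<rho> > eta2 p" using u that by auto
  moreover have "sigma1 p * \<Delta> l \<le> \<Delta> l" if "0 \<le> \<Delta> l" using p that by (simp add: mult_left_le_one_le)
  \<comment> \<open>Positivity of the radius is derived from this lemma, so the sign is read off
    here from the interval \<open>{\<Delta> l..sigma3 p * \<Delta> l}\<close> being
    nonempty.\<close>
  moreover have "0 \<le> \<Delta> l" if "\<rho> > eta2 p"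
  proof -
    have "\<Delta> l \<le> sigma3 p * \<Delta> l" using u that by auto
    then have "0 \<le> (sigma3 p - 1) * \<Delta> l" by (simp add: algebra_simps)
    then show ?thesis using p by (simp add: zero_le_mult_iff)
  qed
  ultimately show "x (Suc l) = y l" "sigma1 p * \<Delta> l \<le> \<Delta> (Suc l)" by fastforce+
qed

lemma rejected_step:
  assumes "\<not> accepted l"
  shows "x (Suc l) = x l" "sigma1 p * \<Delta> l \<le> \<Delta> (Suc l)"
  using update[of l] assms
  unfolding trap_update_def model_self Let_def accepted_def model_decrease_def by auto

lemma x_in_Omega: "x l \<in> Omega C"
proof (induction l)
  case 0 then show ?case by (rule start)
next
  case (Suc l) then show ?case
    using accepted_step(1)[of l] rejected_step(1)[of l] y_in_Omega[of l] by (cases "accepted l") auto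
qed

lemma radius_pos: "0 < \<Delta> l"
proof (induction l)
  case 0 then show ?case by (rule start)
next
  case (Suc l)
  then have "0 < sigma1 p * \<Delta> l" using p by simp
  then show ?case
    using accepted_step(2)[of l] rejected_step(2)[of l] by (cases "accepted l") auto
qed

lemmas iterate_assms = params x_in_Omega symmetric[OF x_in_Omega] b(1) b(2)[OF x_in_Omega] cauchy

lemmas cauchy_decrease_at = cauchy_decrease[OF wf iterate_assms]

lemma model_decrease_ge_cauchy: "gamma1 p * (L (x l) - model L B (x l) (z l)) \<le> model_decrease l"
  using refine[of l] unfolding refinement_def model_decrease_def model_self by blast

text \<open>The Cauchy decrease controls \<open>z l - x l\<close>, and the regularised objective of
  the refinement controls \<open>y l - z l\<close>.\<close>

lemma model_decrease_ge:
  "nu0 p / nu5 p * (norm (z l - x l))\<^sup>2 + sigma_lo p / 2 * (norm (y l - z l))\<^sup>2 \<le> model_decrease l"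
proof -
  obtain \<sigma> where \<sigma>: "sigma_lo p < \<sigma>"
    "model L B (x l) (y l) + \<sigma> / 2 * (norm (y l - z l))\<^sup>2 \<le> model L B (x l) (z l)"
    using refine[of l] unfolding refinement_def by auto
  have "sigma_lo p / 2 * (norm (y l - z l))\<^sup>2 \<le> \<sigma> / 2 * (norm (y l - z l))\<^sup>2"
    using \<sigma>(1) by (intro mult_right_mono) auto
  then show ?thesis
    using \<sigma>(2) cauchy_decrease_at(3)[of l] unfolding model_decrease_def by linarith
qed

lemma model_decrease_nonneg: "0 \<le> model_decrease l"
proof -
  have "0 \<le> nu0 p / nu5 p * (norm (z l - x l))\<^sup>2" "0 \<le> sigma_lo p / 2 * (norm (y l - z l))\<^sup>2"
    using p by auto
  then show ?thesis using model_decrease_ge[of l] by linarith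
qed

lemma accepted_decrease:
  assumes "accepted l"
  shows "eta1 p * model_decrease l \<le> L (x l) - L (x (Suc l))"
proof -
  have "0 < model_decrease l"
  proof (rule ccontr)
    assume "\<not> 0 < model_decrease l"
    then have "model_decrease l = 0" using model_decrease_nonneg[of l] by linarith
    then show False using assms p unfolding accepted_def by simp
  qed
  then show ?thesis
    using assms accepted_step(1)[OF assms] unfolding accepted_def by (simp add: pos_le_divide_eq)
qed

lemma very_successful:
  assumes "0 < model_decrease l" "eta2 p * model_decrease l < L (x l) - L (y l)"
  shows "accepted l" "\<Delta> l \<le> \<Delta> (Suc l)"
proof -
  define \<rho> where "\<rho> = (L (x l) - L (y l)) / model_decrease l"
  have \<rho>: "eta2 p < \<rho>" using assms unfolding \<rho>_def by (simp add: pos_less_divide_eq)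
  then show "accepted l" using p unfolding accepted_def \<rho>_def by simp
  show "\<Delta> l \<le> \<Delta> (Suc l)"
    using update[of l, unfolded trap_update_def model_self, folded model_decrease_def,
      unfolded Let_def, folded \<rho>_def] \<rho> by auto
qed

text \<open>The squared length of \<open>y l - x l\<close> is at most twice the sum of those of
  \<open>z l - x l\<close> and \<open>y l - z l\<close>, each a multiple of the model decrease;
  dividing by \<open>eta1 p\<close> passes to the actual decrease.\<close>

definition step_const :: real where
  "step_const = (2 * nu5 p / nu0 p + 4 / sigma_lo p) / eta1 p"

lemma accepted_step_size:
  assumes "accepted l"
  shows "(norm (z l - x l))\<^sup>2 \<le> step_const * (L (x l) - L (x (Suc l)))"
    and "(norm (y l - x l))\<^sup>2 \<le> step_const * (L (x l) - L (x (Suc l)))"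
proof -
  let ?D = "model_decrease l" and ?a = "norm (z l - x l)" and ?c = "norm (y l - z l)"
  have nn: "0 \<le> nu0 p / nu5 p * ?a\<^sup>2" "0 \<le> sigma_lo p / 2 * ?c\<^sup>2" using p by auto
  have "nu0 p / nu5 p * ?a\<^sup>2 \<le> ?D" "sigma_lo p / 2 * ?c\<^sup>2 \<le> ?D"
    using model_decrease_ge[of l] nn by linarith+
  then have a: "?a\<^sup>2 \<le> nu5 p / nu0 p * ?D" and c: "?c\<^sup>2 \<le> 2 / sigma_lo p * ?D"
    using p by (simp_all add: field_simps)
  have "0 \<le> 2 / sigma_lo p * ?D" "0 \<le> nu5 p / nu0 p * ?D" using p model_decrease_nonneg[of l] by auto
  moreover have "(2 * nu5 p / nu0 p + 4 / sigma_lo p) * ?D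
      = 2 * (nu5 p / nu0 p * ?D) + 2 * (2 / sigma_lo p * ?D)"
    by (simp add: distrib_right)
  ultimately have "?a\<^sup>2 \<le> (2 * nu5 p / nu0 p + 4 / sigma_lo p) * ?D"
    and "2 * ?a\<^sup>2 + 2 * ?c\<^sup>2 \<le> (2 * nu5 p / nu0 p + 4 / sigma_lo p) * ?D"
    using a c zero_le_power2[of ?a] by linarith+
  moreover have "(norm (y l - x l))\<^sup>2 \<le> 2 * ?a\<^sup>2 + 2 * ?c\<^sup>2"
  proof -
    have "norm (y l - x l) \<le> ?c + ?a" using norm_triangle_ineq[of "y l - z l" "z l - x l"] by simp
    then have "(norm (y l - x l))\<^sup>2 \<le> (?c + ?a)\<^sup>2" by (rule power_mono) simp
    also have "\<dots> \<le> 2 * ?a\<^sup>2 + 2 * ?c\<^sup>2"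
      using zero_le_power2[of "?c - ?a"] by (simp add: power2_eq_square algebra_simps)
    finally show ?thesis .
  qed
  moreover have "(2 * nu5 p / nu0 p + 4 / sigma_lo p) * ?D \<le> step_const * (L (x l) - L (x (Suc l)))"
  proof -
    have "(2 * nu5 p / nu0 p + 4 / sigma_lo p) * ?D = step_const * (eta1 p * ?D)"
      unfolding step_const_def using p by simp
    also have "\<dots> \<le> step_const * (L (x l) - L (x (Suc l)))"
      using accepted_decrease[OF assms] p unfolding step_const_def by (intro mult_left_mono) auto
    finally show ?thesis .
  qed
  ultimately show "?a\<^sup>2 \<le> step_const * (L (x l) - L (x (Suc l)))"
    and "(norm (y l - x l))\<^sup>2 \<le> step_const * (L (x l) - L (x (Suc l)))" by linarith+
qed

section \<open>Convergence of the objective values and of the iterates\<close>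

lemma decseq_L: "decseq (\<lambda>l. L (x l))"
proof (rule decseq_SucI)
  fix l
  show "L (x (Suc l)) \<le> L (x l)"
  proof (cases "accepted l")
    case True
    have "0 \<le> eta1 p * model_decrease l" using p model_decrease_nonneg[of l] by simp
    then show ?thesis using accepted_decrease[OF True] by linarith
  next
    case False
    then show ?thesis using rejected_step(1) by simp
  qed
qed

text \<open>Along the convergent subsequence the values tend to \<open>L xs\<close>, and
  monotonicity extends this limit to all of them.\<close>

lemma L_tendsto: "(\<lambda>l. L (x l)) \<longlonglongrightarrow> L xs"
proof -
  obtain r where r: "strict_mono r" "(x \<circ> r) \<longlonglongrightarrow> xs" using limit_point by blast
  have "isCont L xs"
    using differentiable_imp_continuous_within[OF diff_L[OF xs_in]] .
  then have lim: "(\<lambda>i. L (x (r i))) \<longlonglongrightarrow> L xs"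
    using isCont_tendsto_compose[OF _ r(2)] by (simp add: o_def)
  have lower: "L xs \<le> L (x l)" for l
  proof (rule LIMSEQ_le_const2[OF lim])
    have "L (x (r i)) \<le> L (x l)" if "l \<le> i" for i
      using decseqD[OF decseq_L] that seq_suble[OF r(1), of i] by (meson order_trans)
    then show "\<exists>N. \<forall>i\<ge>N. L (x (r i)) \<le> L (x l)" by blast
  qed
  then obtain m where m: "(\<lambda>l. L (x l)) \<longlonglongrightarrow> m"
    using decseq_convergent[OF decseq_L] by blast
  then have "(\<lambda>i. L (x (r i))) \<longlonglongrightarrow> m"
    using LIMSEQ_subseq_LIMSEQ[OF m r(1)] by (simp add: o_def)
  then show ?thesis using LIMSEQ_unique[OF lim] m by simp
qed

lemma accepted_small:
  assumes "0 < e"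
  shows "\<forall>\<^sub>F l in sequentially. accepted l \<longrightarrow> norm (z l - x l) < e \<and> norm (y l - x l) < e"
proof -
  have "(\<lambda>l. step_const * (L (x l) - L (x (Suc l)))) \<longlonglongrightarrow> step_const * (L xs - L xs)"
    by (intro tendsto_intros L_tendsto LIMSEQ_Suc)
  then have "\<forall>\<^sub>F l in sequentially. step_const * (L (x l) - L (x (Suc l))) < e\<^sup>2"
    using assms by (intro order_tendstoD(2)) auto
  then show ?thesis
  proof (rule eventually_mono)
    fix l assume l: "step_const * (L (x l) - L (x (Suc l))) < e\<^sup>2"
    show "accepted l \<longrightarrow> norm (z l - x l) < e \<and> norm (y l - x l) < e"
    proof
      assume "accepted l"
      from accepted_step_size[OF this] l
      have "(norm (z l - x l))\<^sup>2 < e\<^sup>2" "(norm (y l - x l))\<^sup>2 < e\<^sup>2" by linarith+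
      then show "norm (z l - x l) < e \<and> norm (y l - x l) < e"
        using assms by (auto intro: power2_less_imp_less)
    qed
  qed
qed

text \<open>By quadratic growth and monotonicity of \<open>L\<close>, an iterate in a fixed ball around \<open>xs\<close> is in fact
  very close to \<open>xs\<close>, and short steps cannot leave the ball from there.\<close>

lemma x_tendsto: "x \<longlonglongrightarrow> xs"
proof -
  obtain \<delta> where \<delta>: "0 < \<delta>"
    "\<And>x. x \<in> Omega C \<Longrightarrow> norm (x - xs) < \<delta> \<Longrightarrow> L xs + \<kappa> / 4 * (norm (x - xs))\<^sup>2 \<le> L x"
    using quadratic_growth[OF diff_L diff_grad second_order] by blast
  show ?thesis
  proof (rule LIMSEQ_I)
    fix e :: real assume "0 < e"
    \<comment> \<open>With \<open>2 * d \<le> \<delta>\<close>, a step shorter than \<open>d\<close>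
      from inside the \<open>d\<close>-ball ends where quadratic growth still applies.\<close>
    define d where "d = min e \<delta> / 2"
    have d: "0 < d" "2 * d \<le> \<delta>" "d < e" using \<open>0 < e\<close> \<delta>(1) unfolding d_def by auto
    have "L xs < L xs + \<kappa> / 4 * d\<^sup>2" using d(1) second_order(1) by simp
    from order_tendstoD(2)[OF L_tendsto this] accepted_small[OF d(1)]
    have "\<forall>\<^sub>F l in sequentially. L (x l) < L xs + \<kappa> / 4 * d\<^sup>2 \<and> norm (x (Suc l) - x l) < d"
    proof eventually_elim
      case (elim l)
      then show ?case
        using accepted_step(1)[of l] rejected_step(1)[of l] d(1) by (cases "accepted l") auto
    qed
    then obtain N where N: "\<And>l. N \<le> l \<Longrightarrow> L (x l) < L xs + \<kappa> / 4 * d\<^sup>2"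
      "\<And>l. N \<le> l \<Longrightarrow> norm (x (Suc l) - x l) < d"
      unfolding eventually_sequentially by blast
    obtain r where r: "strict_mono r" "(x \<circ> r) \<longlonglongrightarrow> xs" using limit_point by blast
    obtain i where i: "\<And>j. i \<le> j \<Longrightarrow> norm (x (r j) - xs) < d"
      using LIMSEQ_D[OF r(2) d(1)] by auto
    define l0 where "l0 = r (max i N)"
    have "N \<le> l0" unfolding l0_def using seq_suble[OF r(1), of "max i N"] by simp
    have "norm (x l - xs) < d" if "l0 \<le> l" for l
      using that
    proof (induction l rule: dec_induct)
      case base
      then show ?case unfolding l0_def by (rule i) simp
    next
      case (step l)
      have "norm (x (Suc l) - xs) \<le> norm (x (Suc l) - x l) + norm (x l - xs)"
        using norm_triangle_ineq[of "x (Suc l) - x l" "x l - xs"] by simp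
      also have "\<dots> < \<delta>"
        using N(2)[of l] step \<open>N \<le> l0\<close> d(2) by simp
      finally have "L xs + \<kappa> / 4 * (norm (x (Suc l) - xs))\<^sup>2 \<le> L (x (Suc l))"
        by (intro \<delta>(2) x_in_Omega)
      also have "\<dots> < L xs + \<kappa> / 4 * d\<^sup>2" using step \<open>N \<le> l0\<close> by (intro N(1)) simp
      finally have "\<kappa> / 4 * (norm (x (Suc l) - xs))\<^sup>2 < \<kappa> / 4 * d\<^sup>2" by simp
      then have "(norm (x (Suc l) - xs))\<^sup>2 < d\<^sup>2" using second_order(1) by simp
      then show ?case using d(1) by (intro power2_less_imp_less[of "norm (x (Suc l) - xs)" d]) auto
    qed
    then show "\<exists>no. \<forall>n\<ge>no. norm (x n - xs) < e" using d(3) by (meson less_trans)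
  qed
qed

text \<open>Rejections do not move the iterate, so an endless run of them would make the sequence
  constant and equal to its limit \<open>xs\<close>. This point is critical, whereas no iterate
  is.\<close>

lemma infinitely_many_accepted: "\<exists>l\<ge>l0. accepted l"
proof (rule ccontr)
  assume "\<not> (\<exists>l\<ge>l0. accepted l)"
  then have rej: "\<not> accepted l" if "l0 \<le> l" for l using that by blast
  have "x l = x l0" if "l0 \<le> l" for l
    using that by (induction l rule: dec_induct) (auto simp: rejected_step(1)[OF rej])
  then have "\<forall>\<^sub>F l in sequentially. x l = x l0"
    unfolding eventually_sequentially by blast
  then have "x \<longlonglongrightarrow> x l0" by (rule tendsto_eventually)
  then have "x l0 = xs" using x_tendsto LIMSEQ_unique by blast
  then have "critical_point (Omega C) L (x l0)"
    unfolding critical_point_def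
    using xs_in proj_grad_eq_0[OF neg_grad_in_normal_cone] by simp
  then show False using noncritical by blast
qed

end

section \<open>Identification of the active set\<close>

context trap_run
begin

definition off_face :: "nat \<Rightarrow> real" where
  "off_face l = norm (normal_part (x l - xs))"

lemma off_face_nonneg: "0 \<le> off_face l"
  by (simp add: off_face_def)

lemma dist_small:
  assumes "0 < c"
  shows "\<forall>\<^sub>F l in sequentially. a * norm (x l - xs) < c"
proof -
  have "(\<lambda>l. a * norm (x l - xs)) \<longlonglongrightarrow> a * norm (xs - xs)"
    by (intro tendsto_intros x_tendsto)
  then show ?thesis using assms by (intro order_tendstoD(2)) auto
qed

lemma off_face_small:
  assumes "0 < c" "0 \<le> a"
  shows "\<forall>\<^sub>F l in sequentially. a * off_face l < c"
  using dist_small[OF assms(1), of a]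
proof eventually_elim
  case (elim l)
  have "a * off_face l \<le> a * norm (x l - xs)"
    unfolding off_face_def using assms(2) norm_normal_part_le by (intro mult_left_mono) auto
  then show ?case using elim by linarith
qed

lemma gradient_close:
  assumes "0 < \<eta>"
  obtains \<delta> where "0 < \<delta>" "\<And>w. norm (w - xs) < \<delta> \<Longrightarrow> norm (grad L w - grad L xs) < \<eta>"
proof -
  have "isCont (grad L) xs"
    using differentiable_imp_continuous_within[OF diff_grad] .
  then show ?thesis
    using assms that unfolding continuous_at_eps_delta dist_norm by metis
qed

lemma gradient_close_eventually:
  assumes "0 < \<eta>"
  shows "\<forall>\<^sub>F l in sequentially. norm (grad L (x l) - grad L xs) < \<eta>"
proof -
  obtain \<delta> where \<delta>: "0 < \<delta>" "\<And>w. norm (w - xs) < \<delta> \<Longrightarrow> norm (grad L w - grad L xs) < \<eta>"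
    using gradient_close[OF assms] by blast
  show ?thesis
    using dist_small[OF \<delta>(1), of 1] by (rule eventually_mono) (use \<delta>(2) in simp)
qed

abbreviation block_grad :: "nat \<Rightarrow> nat \<Rightarrow> real ^ 'n" where
  "block_grad l k \<equiv> partial_grad C L B (x l) (z l) k"

text \<open>\<open>step_min\<close> collects the two lower bounds on the step length that do not
  involve the radius; \<open>step_slope\<close>, below, is the factor of the radius in the third,
  with the block gradient bounded by \<open>norm (grad L xs) + \<epsilon>\<close>.\<close>

definition step_min :: real where
  "step_min = min (nu4 p) (nu3 p * (2 * (1 - nu0 p) / b))"

definition step_slope :: "real \<Rightarrow> real" where
  "step_slope \<epsilon> = nu3 p * nu1 p / (norm (grad L xs) + \<epsilon>)"

lemma step_min_pos: "0 < step_min"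
  using p b(1) unfolding step_min_def by simp

lemma step_slope_pos: "0 < \<epsilon> \<Longrightarrow> 0 < step_slope \<epsilon>"
  using p unfolding step_slope_def by (intro divide_pos_pos mult_pos_pos) (auto intro: add_nonneg_pos)

lemma cauchy_step:
  assumes "k \<in> {1..num_blocks C}" "0 < \<epsilon>"
    and "norm (grad L (x l) - grad L xs) + b * norm (z l - x l) \<le> \<epsilon> / 2"
  obtains \<alpha> where "0 < \<alpha>"
    "block C k (z l) = closest_point (Omega_block C k) (block C k (x l) - \<alpha> *\<^sub>R block_grad l k)"
    "infnorm (block C k (z l) - block C k (x l)) \<le> nu2 p * \<Delta> l"
    "step_min \<le> \<alpha> \<or> step_slope \<epsilon> * \<Delta> l \<le> \<alpha>"
    "norm (block_grad l k - block C k (grad L xs)) \<le> \<epsilon> / 2"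
proof (rule cauchy_point_block[OF iterate_assms assms(1)])
  fix \<alpha>
  assume \<alpha>: "0 < \<alpha>"
    "block C k (z l) = closest_point (Omega_block C k) (block C k (x l) - \<alpha> *\<^sub>R block_grad l k)"
    "infnorm (block C k (z l) - block C k (x l)) \<le> nu2 p * \<Delta> l"
    and lower: "nu4 p \<le> \<alpha> \<or> nu3 p * (2 * (1 - nu0 p) / b) \<le> \<alpha> \<or>
      nu3 p * nu1 p * \<Delta> l \<le> \<alpha> * norm (block_grad l k)"
  have G: "norm (block_grad l k - block C k (grad L xs)) \<le> \<epsilon> / 2"
    using norm_partial_grad_diff_le[of B "x l" b, OF b(2)[OF x_in_Omega]] assms(3)
    by (rule order_trans)
  have "norm (block_grad l k) \<le> norm (block_grad l k - block C k (grad L xs)) + norm (block C k (grad L xs))"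
    using norm_triangle_ineq[of "block_grad l k - block C k (grad L xs)" "block C k (grad L xs)"] by simp
  then have bound: "norm (block_grad l k) \<le> norm (grad L xs) + \<epsilon>"
    using G norm_block_le[of C k "grad L xs"] assms(2) by linarith
  have "step_min \<le> \<alpha> \<or> step_slope \<epsilon> * \<Delta> l \<le> \<alpha>"
  proof (cases "step_min \<le> \<alpha>")
    case False
    then have "nu3 p * nu1 p * \<Delta> l \<le> \<alpha> * norm (block_grad l k)"
      using lower unfolding step_min_def by linarith
    also have "\<dots> \<le> \<alpha> * (norm (grad L xs) + \<epsilon>)"
      using bound \<alpha>(1) by (intro mult_left_mono) auto
    finally have "nu3 p * nu1 p * \<Delta> l \<le> \<alpha> * (norm (grad L xs) + \<epsilon>)" .
    moreover have "0 < norm (grad L xs) + \<epsilon>" using assms(2) by (intro add_nonneg_pos) auto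
    ultimately show ?thesis unfolding step_slope_def by (simp add: pos_divide_le_eq)
  qed simp
  then show ?thesis using that[OF \<alpha>] G by blast
qed

text \<open>The refinement keeps the constraints active at \<open>z l\<close>, so if
  \<open>y l\<close> misses the face, then so does some block of \<open>z l\<close>, and its step
  length is at most \<open>2 * off_face l / \<epsilon>\<close>. This is eventually below
  \<open>step_min\<close>, so the bound proportional to the radius must hold. Acceptance is used
  because it places \<open>y l\<close> and \<open>z l\<close> near \<open>xs\<close> however large
  the radius is.\<close>

lemma accepted_off_face_radius:
  obtains M where "0 < M"
    "\<forall>\<^sub>F l in sequentially. accepted l \<longrightarrow> active C (y l) \<noteq> active C xs \<longrightarrow> \<Delta> l \<le> M * off_face l"
proof -
  obtain \<epsilon> where \<epsilon>: "0 < \<epsilon>"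
    "\<And>x. x \<in> Omega C \<Longrightarrow> \<epsilon> * norm (normal_part (x - xs)) \<le> grad L xs \<bullet> normal_part (x - xs)"
    using grad_linear_growth by blast
  obtain r where r: "0 < r"
    "\<And>x. norm (x - xs) < r \<Longrightarrow> x - normal_part (x - xs) \<in> Omega C"
    "\<And>x. norm (x - xs) < r \<Longrightarrow> active C x \<subseteq> active C xs"
    "\<And>x. norm (x - xs) < r \<Longrightarrow> x \<in> Omega C \<Longrightarrow>
       active C xs \<subseteq> active C x \<longleftrightarrow> normal_part (x - xs) = 0"
    using face_neighbourhood by blast
  define M where "M = 2 / (\<epsilon> * step_slope \<epsilon>)"
  \<comment> \<open>Drift of the gradient and of the sweep get \<open>\<epsilon> / 4\<close> each,
    adding up to the tolerance of \<open>cauchy_step\<close>; \<open>r / 2\<close> twice keeps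
    \<open>z l\<close> and \<open>y l\<close> within \<open>r\<close> of \<open>xs\<close>; the last
    threshold excludes \<open>step_min \<le> \<alpha>\<close>.\<close>
  have e4: "0 < \<epsilon> / 4" "0 < \<epsilon> / (4 * b)" "0 < r / 2" "0 < \<epsilon> * step_min"
    using \<epsilon>(1) b(1) r(1) step_min_pos by auto
  show ?thesis
  proof (rule that)
    show "0 < M" unfolding M_def using \<epsilon>(1) step_slope_pos by simp
    show "\<forall>\<^sub>F l in sequentially. accepted l \<longrightarrow> active C (y l) \<noteq> active C xs \<longrightarrow> \<Delta> l \<le> M * off_face l"
      using gradient_close_eventually[OF e4(1)] accepted_small[OF e4(2)] accepted_small[OF e4(3)]
        dist_small[OF e4(3), of 1] off_face_small[OF e4(4), of 2, OF zero_le_numeral]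
    proof eventually_elim
      case (elim l)
      show ?case
      proof (intro impI)
        assume acc: "accepted l" and ne: "active C (y l) \<noteq> active C xs"
        have near: "norm (z l - x l) < r / 2" "norm (y l - x l) < r / 2" "norm (x l - xs) < r / 2"
          using elim acc by auto
        have zr: "norm (z l - xs) < r" and yr: "norm (y l - xs) < r"
          using near norm_triangle_ineq[of "z l - x l" "x l - xs"]
            norm_triangle_ineq[of "y l - x l" "x l - xs"] by auto
        have "b * norm (z l - x l) \<le> b * (\<epsilon> / (4 * b))"
          using elim acc b(1) by (intro mult_left_mono) auto
        also have "\<dots> = \<epsilon> / 4" using b(1) by simp
        finally have close: "norm (grad L (x l) - grad L xs) + b * norm (z l - x l) \<le> \<epsilon> / 2"
          using elim(1) by linarith
        have "active C (z l) \<subseteq> active C (y l)"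
          using refine[of l] unfolding refinement_def active_def by blast
        moreover have "\<not> active C xs \<subseteq> active C (y l)" using ne r(3)[OF yr] by blast
        ultimately have "normal_part (z l - xs) \<noteq> 0" using r(4)[OF zr z_in_Omega] by blast
        moreover have "(\<Sum>k\<in>{1..num_blocks C}. block C k (normal_part (z l - xs))) = normal_part (z l - xs)"
          by (rule sum_blocks[OF wf])
        ultimately obtain k where k: "k \<in> {1..num_blocks C}" "block C k (normal_part (z l - xs)) \<noteq> 0"
          by (metis sum.neutral)
        obtain \<alpha> where \<alpha>: "0 < \<alpha>"
          "block C k (z l) = closest_point (Omega_block C k) (block C k (x l) - \<alpha> *\<^sub>R block_grad l k)"
          "step_min \<le> \<alpha> \<or> step_slope \<epsilon> * \<Delta> l \<le> \<alpha>"
          "norm (block_grad l k - block C k (grad L xs)) \<le> \<epsilon> / 2"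
          by (rule cauchy_step[OF k(1) \<epsilon>(1) close]) (rule that; assumption)
        have le: "\<epsilon> * \<alpha> \<le> 2 * off_face l"
          unfolding off_face_def
          by (rule projected_step_off_face[OF \<epsilon>(2) z_in_Omega r(2)[OF zr] k(1) \<alpha>(4,2,1) k(2)])
        have "\<epsilon> * \<alpha> < \<epsilon> * step_min" using le elim(5) by linarith
        then have "\<alpha> < step_min" using \<epsilon>(1) by simp
        then have "step_slope \<epsilon> * \<Delta> l \<le> \<alpha>" using \<alpha>(3) by linarith
        then have "\<epsilon> * (step_slope \<epsilon> * \<Delta> l) \<le> \<epsilon> * \<alpha>"
          using \<epsilon>(1) by (intro mult_left_mono) auto
        then have "\<Delta> l * (\<epsilon> * step_slope \<epsilon>) \<le> 2 * off_face l"
          using le by (simp add: algebra_simps)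
        then show "\<Delta> l \<le> M * off_face l"
          unfolding M_def using \<epsilon>(1) step_slope_pos[OF \<epsilon>(1)] by (simp add: pos_le_divide_eq)
      qed
    qed
  qed
qed

lemma norm_step_le:
  assumes "\<And>k. k \<in> {1..num_blocks C} \<Longrightarrow> infnorm (block C k v) \<le> c"
  shows "norm v \<le> real (num_blocks C) * (sqrt DIM(real ^ 'n) * c)"
proof -
  have "norm v = norm (\<Sum>k\<in>{1..num_blocks C}. block C k v)" by (simp only: sum_blocks[OF wf])
  also have "\<dots> \<le> (\<Sum>k\<in>{1..num_blocks C}. norm (block C k v))" by (rule norm_sum)
  also have "\<dots> \<le> (\<Sum>k\<in>{1..num_blocks C}. sqrt DIM(real ^ 'n) * c)"
  proof (rule sum_mono)
    fix k assume "k \<in> {1..num_blocks C}"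
    then have "sqrt DIM(real ^ 'n) * infnorm (block C k v) \<le> sqrt DIM(real ^ 'n) * c"
      by (intro mult_left_mono assms) auto
    with norm_le_infnorm[of "block C k v"] show "norm (block C k v) \<le> sqrt DIM(real ^ 'n) * c"
      by (rule order_trans)
  qed
  also have "\<dots> = real (num_blocks C) * (sqrt DIM(real ^ 'n) * c)" by simp
  finally show ?thesis .
qed

lemma num_blocks_pos: "0 < num_blocks C"
proof -
  have "block_of C undefined \<in> {1..num_blocks C}"
    using wf unfolding wf_constraints_def by blast
  then show ?thesis by simp
qed

text \<open>By the triangle inequality the largest block qualifies. Applied to the normal part, it
  selects a block whose distance to the face is comparable with the total one.\<close>

lemma large_block:
  obtains k where "k \<in> {1..num_blocks C}" "norm v \<le> real (num_blocks C) * norm (block C k v)"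
proof -
  let ?K = "{1..num_blocks C}"
  have K: "?K \<noteq> {}" using num_blocks_pos by simp
  define m where "m = Max ((\<lambda>k. norm (block C k v)) ` ?K)"
  have "m \<in> (\<lambda>k. norm (block C k v)) ` ?K" unfolding m_def using K by (intro Max_in) auto
  then obtain k where k: "k \<in> ?K" "m = norm (block C k v)" by blast
  have "norm v = norm (\<Sum>k\<in>?K. block C k v)" by (simp only: sum_blocks[OF wf])
  also have "\<dots> \<le> (\<Sum>k\<in>?K. norm (block C k v))" by (rule norm_sum)
  also have "\<dots> \<le> (\<Sum>k\<in>?K. m)" unfolding m_def by (intro sum_mono Max_ge) auto
  also have "\<dots> = real (num_blocks C) * m" by simp
  finally show ?thesis using that k by simp
qed

text \<open>Off the face, the Cauchy step decreases the model linearly in the radius, whereas the model error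
  is of smaller order; hence small trust regions lead to very successful iterations.\<close>

lemma small_radius_very_successful:
  assumes "0 < M"
  shows "\<forall>\<^sub>F l in sequentially. \<Delta> l \<le> M * off_face l \<longrightarrow> accepted l \<and> \<Delta> l \<le> \<Delta> (Suc l)"
proof -
  obtain \<epsilon> where \<epsilon>: "0 < \<epsilon>"
    "\<And>x. x \<in> Omega C \<Longrightarrow> \<epsilon> * norm (normal_part (x - xs)) \<le> grad L xs \<bullet> normal_part (x - xs)"
    using grad_linear_growth by blast
  obtain r where r: "0 < r"
    "\<And>x. norm (x - xs) < r \<Longrightarrow> x - normal_part (x - xs) \<in> Omega C"
    "\<And>x. norm (x - xs) < r \<Longrightarrow> active C x \<subseteq> active C xs"
    "\<And>x. norm (x - xs) < r \<Longrightarrow> x \<in> Omega C \<Longrightarrow>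
       active C xs \<subseteq> active C x \<longleftrightarrow> normal_part (x - xs) = 0"
    using face_neighbourhood by blast
  define K where "K = real (num_blocks C)"
  have K: "0 < K" unfolding K_def using num_blocks_pos by simp
  define Z where "Z = K * (sqrt DIM(real ^ 'n) * nu2 p)"
  define Y where "Y = sqrt DIM(real ^ 'n) * gamma2 p"
  have Z: "0 \<le> Z" and Y: "0 < Y" unfolding Z_def Y_def using K p by simp_all
  \<comment> \<open>The two entries bound the two sides of the minimum in
    \<open>projected_step_decrease_off_face\<close> per unit of radius: \<Delta> is at most
    \<open>M * K\<close> times the chosen block of the normal part, and
    \<open>step_slope \<epsilon> * \<Delta> l \<le> \<alpha>\<close>.\<close>
  define c where "c = \<epsilon> / 4 * min (1 / (M * K)) (\<epsilon> / 2 * step_slope \<epsilon>)"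
  have c: "0 < c" unfolding c_def using \<epsilon>(1) assms K step_slope_pos by simp
  define c' where "c' = gamma1 p * (nu0 p * c)"
  have c': "0 < c'" unfolding c'_def using p c by simp
  \<comment> \<open>The model error will be at most \<open>3 * \<eta> * Y * \<Delta> l\<close>:
    \<open>2 * \<eta>\<close> from the gradients, both compared with that at \<open>xs\<close>, and
    \<eta> from half the quadratic term. The fourth \<eta> makes the final inequality
    strict.\<close>
  define \<eta> where "\<eta> = (1 - eta2 p) * c' / (4 * Y)"
  have \<eta>: "0 < \<eta>" "(1 - eta2 p) * c' = 4 * \<eta> * Y" unfolding \<eta>_def using p c' Y by simp_all
  obtain \<delta> where \<delta>: "0 < \<delta>" "\<And>w. norm (w - xs) < \<delta> \<Longrightarrow> norm (grad L w - grad L xs) < \<eta>"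
    using gradient_close[OF \<eta>(1)] by blast
  have pos: "0 < \<epsilon> / 4" "0 < r" "0 < \<delta> / 2" using \<epsilon>(1) r(1) \<delta>(1) by auto
  have nonneg: "0 \<le> b * Z * M" "0 \<le> Y * M" "0 \<le> step_slope \<epsilon> * M" "0 \<le> b * Y * M"
    using b(1) Z Y assms step_slope_pos[OF \<epsilon>(1)] by auto
  show ?thesis
    using gradient_close_eventually[OF pos(1)] dist_small[OF pos(2), of 1] dist_small[OF pos(3), of 1]
      off_face_small[OF pos(1) nonneg(1)] off_face_small[OF pos(3) nonneg(2)]
      off_face_small[OF step_min_pos nonneg(3)] off_face_small[OF \<eta>(1) nonneg(4)]
  proof eventually_elim
    case (elim l)
    show ?case
    proof
      assume small: "\<Delta> l \<le> M * off_face l"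
      have xr: "norm (x l - xs) < r" using elim(2) by linarith
      have scaled: "a * \<Delta> l \<le> a * M * off_face l" if "0 \<le> a" for a
        using mult_left_mono[OF small that] by (simp add: mult.assoc)
      have y_len: "norm (y l - x l) \<le> Y * \<Delta> l"
      proof -
        have "sqrt DIM(real ^ 'n) * infnorm (y l - x l) \<le> sqrt DIM(real ^ 'n) * (gamma2 p * \<Delta> l)"
          using refine[of l] unfolding refinement_def by (intro mult_left_mono) auto
        with norm_le_infnorm show ?thesis unfolding Y_def mult.assoc by (rule order_trans)
      qed
      have len_z: "norm (z l - x l) \<le> Z * \<Delta> l"
      proof -
        have "infnorm (block C k (z l - x l)) \<le> nu2 p * \<Delta> l" if k: "k \<in> {1..num_blocks C}" for k
          unfolding block_diff by (rule cauchy_point_block[OF iterate_assms k])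
        from norm_step_le[OF this] show ?thesis unfolding Z_def K_def by (simp only: mult.assoc)
      qed
      have "b * norm (z l - x l) \<le> b * (Z * \<Delta> l)"
        using len_z b(1) by (intro mult_left_mono) auto
      also have "\<dots> \<le> b * Z * M * off_face l"
        using scaled[of "b * Z"] b(1) Z by (simp add: mult.assoc)
      finally have close: "norm (grad L (x l) - grad L xs) + b * norm (z l - x l) \<le> \<epsilon> / 2"
        using elim(1,4) by linarith
      \<comment> \<open>The radius is small here, so either lower bound on the step length yields
        the one proportional to the radius.\<close>
      have slope: "step_slope \<epsilon> * \<Delta> l < step_min"
        using scaled[of "step_slope \<epsilon>"] step_slope_pos[OF \<epsilon>(1)] elim(6) by linarith
      let ?e = "\<lambda>k. - (block_grad l k \<bullet> (block C k (z l) - block C k (x l)))"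
      have e_nonneg: "0 \<le> ?e k" if "k \<in> {1..num_blocks C}" for k
      proof -
        have "0 \<le> (norm (block C k (z l) - block C k (x l)))\<^sup>2 / nu5 p" using p by simp
        then show ?thesis using cauchy_decrease_at(2)[OF that, of l] by linarith
      qed
      obtain k where k: "k \<in> {1..num_blocks C}"
        "off_face l \<le> K * norm (block C k (normal_part (x l - xs)))"
        using large_block unfolding K_def off_face_def by blast
      have "c * \<Delta> l \<le> ?e k"
      proof (rule cauchy_step[OF k(1) \<epsilon>(1) close])
        fix \<alpha>
        assume \<alpha>: "0 < \<alpha>"
          "block C k (z l) = closest_point (Omega_block C k) (block C k (x l) - \<alpha> *\<^sub>R block_grad l k)"
          "step_min \<le> \<alpha> \<or> step_slope \<epsilon> * \<Delta> l \<le> \<alpha>"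
          "norm (block_grad l k - block C k (grad L xs)) \<le> \<epsilon> / 2"
        have "\<Delta> l \<le> M * (K * norm (block C k (normal_part (x l - xs))))"
          using small mult_left_mono[OF k(2), of M] assms by linarith
        then have "1 / (M * K) * \<Delta> l \<le> norm (block C k (normal_part (x l - xs)))"
          using assms K by (simp add: pos_divide_le_eq mult.commute mult.left_commute)
        moreover have "\<epsilon> / 2 * step_slope \<epsilon> * \<Delta> l \<le> \<epsilon> / 2 * \<alpha>"
          unfolding mult.assoc using \<alpha>(3) slope \<epsilon>(1) by (intro mult_left_mono) linarith+
        moreover have "min (1 / (M * K)) (\<epsilon> / 2 * step_slope \<epsilon>) * \<Delta> l \<le> 1 / (M * K) * \<Delta> l"
          "min (1 / (M * K)) (\<epsilon> / 2 * step_slope \<epsilon>) * \<Delta> l \<le> \<epsilon> / 2 * step_slope \<epsilon> * \<Delta> l"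
          using radius_pos[of l] by (intro mult_right_mono; simp)+
        ultimately have "min (1 / (M * K)) (\<epsilon> / 2 * step_slope \<epsilon>) * \<Delta> l
            \<le> min (norm (block C k (normal_part (x l - xs)))) (\<epsilon> / 2 * \<alpha>)"
          by linarith
        then have "c * \<Delta> l \<le> \<epsilon> / 4 * min (norm (block C k (normal_part (x l - xs)))) (\<epsilon> / 2 * \<alpha>)"
          unfolding c_def mult.assoc using \<epsilon>(1) by (intro mult_left_mono) auto
        also have "\<dots> \<le> ?e k"
          by (rule projected_step_decrease_off_face[OF \<epsilon>(2,1) x_in_Omega r(2)[OF xr] k(1) \<alpha>(4,2,1)])
        finally show ?thesis .
      qed
      also have "?e k \<le> (\<Sum>k\<in>{1..num_blocks C}. ?e k)"
        using k(1) e_nonneg by (intro member_le_sum) auto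
      finally have "nu0 p * (c * \<Delta> l) \<le> nu0 p * (\<Sum>k\<in>{1..num_blocks C}. ?e k)"
        using p by (intro mult_left_mono) auto
      then have "nu0 p * (c * \<Delta> l) \<le> L (x l) - model L B (x l) (z l)"
        using cauchy_decrease_at(1) by (rule order_trans)
      then have "gamma1 p * (nu0 p * (c * \<Delta> l)) \<le> gamma1 p * (L (x l) - model L B (x l) (z l))"
        using p by (intro mult_left_mono) auto
      then have md: "c' * \<Delta> l \<le> model_decrease l"
        using model_decrease_ge_cauchy[of l] unfolding c'_def by (simp add: mult.assoc)
      have "0 < c' * \<Delta> l" using c' radius_pos by simp
      then have md_pos: "0 < model_decrease l" using md by linarith
      have yd: "norm (y l - xs) < \<delta>"
      proof -
        have "norm (y l - x l) < \<delta> / 2"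
          using y_len scaled[of Y] Y elim(5) by linarith
        then show ?thesis
          using elim(3) norm_triangle_ineq[of "y l - x l" "x l - xs"] by simp
      qed
      have xd: "norm (x l - xs) < \<delta>" using elim(3) \<delta>(1) by simp
      have "\<bar>L (y l) - L (x l) - grad L (x l) \<bullet> (y l - x l)\<bar> \<le> 2 * \<eta> * norm (y l - x l)"
      proof (rule first_order_remainder[of "Omega C \<inter> ball xs \<delta>"])
        show "convex (Omega C \<inter> ball xs \<delta>)" by (intro convex_Int convex_Omega[OF wf] convex_ball)
        show "x l \<in> Omega C \<inter> ball xs \<delta>" "y l \<in> Omega C \<inter> ball xs \<delta>"
          using x_in_Omega y_in_Omega xd yd by (auto simp: dist_norm norm_minus_commute)
        fix w assume w: "w \<in> Omega C \<inter> ball xs \<delta>"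
        then show "L differentiable (at w)" using diff_L by blast
        have "norm (grad L w - grad L xs) < \<eta>"
          using w by (intro \<delta>(2)) (simp add: dist_norm norm_minus_commute)
        moreover have "norm (grad L (x l) - grad L xs) < \<eta>" using xd by (rule \<delta>(2))
        ultimately show "norm (grad L w - grad L (x l)) \<le> 2 * \<eta>"
          using norm_triangle_ineq4[of "grad L w - grad L xs" "grad L (x l) - grad L xs"] by simp
      qed
      \<comment> \<open>The step length is at most \<open>Y * M * off_face l\<close>, which tends to
        zero; one factor of the quadratic term, together with \<open>b\<close>, is thus absorbed
        into \<eta>.\<close>
      moreover have "\<bar>(y l - x l) \<bullet> (B (x l) *v (y l - x l))\<bar> \<le> 2 * \<eta> * norm (y l - x l)"
      proof -
        have "b * norm (y l - x l) \<le> b * (Y * \<Delta> l)"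
          using y_len b(1) by (intro mult_left_mono) auto
        also have "\<dots> \<le> \<eta>"
        proof -
          have "0 \<le> b * Y" using b(1) Y by simp
          from scaled[OF this] elim(7) show ?thesis unfolding mult.assoc[symmetric] by linarith
        qed
        also have "\<dots> \<le> 2 * \<eta>" using \<eta>(1) by simp
        finally have "b * norm (y l - x l) * norm (y l - x l) \<le> 2 * \<eta> * norm (y l - x l)"
          by (rule mult_right_mono) simp
        then show ?thesis
          using abs_quadratic_le[OF b(2)[OF x_in_Omega[of l]], of "y l - x l"]
          by (simp add: power2_eq_square mult.assoc)
      qed
      ultimately have "L (y l) - model L B (x l) (y l) \<le> 3 * \<eta> * norm (y l - x l)"
        unfolding model_def by (simp add: abs_le_iff)
      also have "\<dots> \<le> 3 * \<eta> * (Y * \<Delta> l)" using y_len \<eta>(1) by (intro mult_left_mono) auto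
      also have "\<dots> < 4 * \<eta> * (Y * \<Delta> l)" using \<eta>(1) Y radius_pos[of l] by simp
      also have "\<dots> = (1 - eta2 p) * (c' * \<Delta> l)" using \<eta>(2) by (simp only: mult.assoc[symmetric])
      also have "\<dots> \<le> (1 - eta2 p) * model_decrease l" using md p by (intro mult_left_mono) auto
      finally have "eta2 p * model_decrease l < L (x l) - L (y l)"
        unfolding model_decrease_def by (simp add: algebra_simps)
      then show "accepted l \<and> \<Delta> l \<le> \<Delta> (Suc l)" using very_successful[OF md_pos] by blast
    qed
  qed
qed

section \<open>Reaching the face and staying on it\<close>

lemma off_face_eq_0_iff:
  "\<forall>\<^sub>F l in sequentially. active C (x l) = active C xs \<longleftrightarrow> off_face l = 0"
proof -
  obtain r where r: "0 < r"
    "\<And>x. norm (x - xs) < r \<Longrightarrow> x - normal_part (x - xs) \<in> Omega C"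
    "\<And>x. norm (x - xs) < r \<Longrightarrow> active C x \<subseteq> active C xs"
    "\<And>x. norm (x - xs) < r \<Longrightarrow> x \<in> Omega C \<Longrightarrow>
       active C xs \<subseteq> active C x \<longleftrightarrow> normal_part (x - xs) = 0"
    using face_neighbourhood by blast
  show ?thesis
    using dist_small[OF r(1), of 1]
  proof eventually_elim
    case (elim l)
    then have "norm (x l - xs) < r" by simp
    have "active C (x l) = active C xs \<longleftrightarrow> active C xs \<subseteq> active C (x l)"
      using r(3)[OF \<open>norm (x l - xs) < r\<close>] by blast
    also have "\<dots> \<longleftrightarrow> off_face l = 0"
      unfolding off_face_def norm_eq_zero by (rule r(4)[OF \<open>norm (x l - xs) < r\<close> x_in_Omega])
    finally show ?case .
  qed
qed

lemma eventually_active_eq: "\<forall>\<^sub>F l in sequentially. active C (x l) = active C xs"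
proof -
  obtain M where M: "0 < M"
    "\<forall>\<^sub>F l in sequentially. accepted l \<longrightarrow> active C (y l) \<noteq> active C xs \<longrightarrow> \<Delta> l \<le> M * off_face l"
    using accepted_off_face_radius by blast
  define M' where "M' = M / sigma1 p"
  have M': "0 < M'" "M = sigma1 p * M'" "M < M'"
    using M(1) p unfolding M'_def by (auto simp: pos_less_divide_eq)
  have "\<forall>\<^sub>F l in sequentially.
      (accepted l \<longrightarrow> active C (x (Suc l)) \<noteq> active C xs \<longrightarrow> \<Delta> l \<le> M * off_face l) \<and>
      (\<Delta> l \<le> M' * off_face l \<longrightarrow> accepted l \<and> \<Delta> l \<le> \<Delta> (Suc l)) \<and>
      (active C (x l) = active C xs \<longleftrightarrow> off_face l = 0)"
    using M(2) small_radius_very_successful[OF M'(1)] off_face_eq_0_iff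
  proof eventually_elim
    case (elim l)
    have "accepted l \<longrightarrow> active C (x (Suc l)) \<noteq> active C xs \<longrightarrow> \<Delta> l \<le> M * off_face l"
      using elim(1) accepted_step(1)[of l] by metis
    then show ?case using elim(2,3) by blast
  qed
  then obtain N where N: "\<forall>l\<ge>N.
      (accepted l \<longrightarrow> active C (x (Suc l)) \<noteq> active C xs \<longrightarrow> \<Delta> l \<le> M * off_face l) \<and>
      (\<Delta> l \<le> M' * off_face l \<longrightarrow> accepted l \<and> \<Delta> l \<le> \<Delta> (Suc l)) \<and>
      (active C (x l) = active C xs \<longleftrightarrow> off_face l = 0)"
    unfolding eventually_sequentially ..
  have N1: "\<Delta> l \<le> M * off_face l"
    if "N \<le> l" "accepted l" "active C (x (Suc l)) \<noteq> active C xs" for l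
    using N that by blast
  have N2: "accepted l" "\<Delta> l \<le> \<Delta> (Suc l)" if "N \<le> l" "\<Delta> l \<le> M' * off_face l" for l
    using N that by blast+
  have N3: "active C (x l) = active C xs \<longleftrightarrow> off_face l = 0" if "N \<le> l" for l
    using N that by blast
  have persist: "active C (x (Suc l)) = active C xs" if "N \<le> l" "active C (x l) = active C xs" for l
  proof (cases "accepted l")
    case True
    show ?thesis
    proof (rule ccontr)
      assume "active C (x (Suc l)) \<noteq> active C xs"
      then have "\<Delta> l \<le> M * off_face l" by (rule N1[OF that(1) True])
      then show False using N3[OF that(1)] that(2) radius_pos[of l] by simp
    qed
  next
    case False
    then show ?thesis using that(2) rejected_step(1) by simp
  qed
  have "\<exists>l\<ge>N. active C (x l) = active C xs"
  proof (rule ccontr)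
    assume "\<not> (\<exists>l\<ge>N. active C (x l) = active C xs)"
    then have never: "active C (x l) \<noteq> active C xs" if "N \<le> l" for l using that by blast
    have acc: "\<Delta> l \<le> M * off_face l" if "N \<le> l" "accepted l" for l
    proof (rule N1[OF that])
      show "active C (x (Suc l)) \<noteq> active C xs" using never[of "Suc l"] that(1) by simp
    qed
    have rej: "\<not> accepted (Suc l)" if l: "N \<le> l" "\<not> accepted l" for l
    proof
      assume "accepted (Suc l)"
      then have "\<Delta> (Suc l) \<le> M * off_face (Suc l)" using acc l(1) by simp
      \<comment> \<open>A rejection leaves the iterate in place and shrinks only the radius, by a
        factor of at least \<open>sigma1 p\<close>, so the bound at \<open>Suc l\<close> transfers
        back to \<open>l\<close> with \<open>M'\<close> for \<open>M\<close>.\<close>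
      moreover have "off_face (Suc l) = off_face l"
        unfolding off_face_def rejected_step(1)[OF l(2)] ..
      ultimately have "sigma1 p * \<Delta> l \<le> sigma1 p * (M' * off_face l)"
        using rejected_step(2)[OF l(2)] M'(2) by (simp add: mult.assoc)
      then have "\<Delta> l \<le> M' * off_face l" using p by simp
      then show False using N2(1)[OF l(1)] l(2) by blast
    qed
    have all_acc: "accepted l" if "N \<le> l" for l
    proof (rule ccontr)
      assume "\<not> accepted l"
      have "\<not> accepted l'" if "l \<le> l'" for l'
        using that
      proof (induction l' rule: dec_induct)
        case base
        show ?case by fact
      next
        case (step m)
        then show ?case using rej[of m] \<open>N \<le> l\<close> by simp
      qed
      then show False using infinitely_many_accepted[of l] by blast
    qed
    have grow: "\<Delta> N \<le> \<Delta> l" if "N \<le> l" for l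
      using that
    proof (induction l rule: dec_induct)
      case (step m)
      have "\<Delta> m \<le> M * off_face m" by (rule acc[OF step(1) all_acc[OF step(1)]])
      also have "\<dots> \<le> M' * off_face m" using M'(3) off_face_nonneg by (intro mult_right_mono) auto
      finally have "\<Delta> m \<le> \<Delta> (Suc m)" by (rule N2(2)[OF step(1)])
      with step.IH show ?case by (rule order_trans)
    qed simp
    have "\<forall>\<^sub>F l in sequentially. M * off_face l < \<Delta> N"
      using M(1) radius_pos by (intro off_face_small) auto
    moreover have "\<forall>\<^sub>F l in sequentially. N \<le> l" by (rule eventually_ge_at_top)
    ultimately have "\<forall>\<^sub>F l in sequentially. False"
    proof eventually_elim
      case (elim l)
      then show ?case using acc[OF elim(2) all_acc[OF elim(2)]] grow[OF elim(2)] by linarith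
    qed
    then show False by simp
  qed
  then obtain l0 where l0: "N \<le> l0" "active C (x l0) = active C xs" by blast
  have "active C (x l) = active C xs" if "l0 \<le> l" for l
    using that
  proof (induction l rule: dec_induct)
    case base
    show ?case by (rule l0)
  next
    case (step m)
    then show ?case using persist[of m] l0(1) by simp
  qed
  then show ?thesis unfolding eventually_sequentially by blast
qed

text \<open>The projected gradient need not be continuous, because the tangent cone jumps when the
  active set changes. Once the active set is that of \<open>xs\<close>, the cone is fixed, and
  projection onto a fixed closed convex set is continuous; at \<open>xs\<close> the result is
  zero.\<close>

lemma proj_grad_tendsto: "(\<lambda>l. norm (proj_grad (Omega C) L (x l))) \<longlonglongrightarrow> 0"
proof -
  let ?T = "tangent_cone (Omega C) xs"
  note T = tangent_cone_Omega_closed_convex[OF wf xs_in]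
  have "isCont (grad L) xs"
    using differentiable_imp_continuous_within[OF diff_grad] .
  then have "(\<lambda>l. - grad L (x l)) \<longlonglongrightarrow> - grad L xs"
    by (rule tendsto_minus[OF isCont_tendsto_compose[OF _ x_tendsto]])
  moreover have "isCont (closest_point ?T) (- grad L xs)"
    using T by (intro continuous_at_closest_point) auto
  ultimately have "(\<lambda>l. closest_point ?T (- grad L (x l))) \<longlonglongrightarrow> proj_grad (Omega C) L xs"
    unfolding proj_grad_def by (rule isCont_tendsto_compose[rotated])
  then have "(\<lambda>l. closest_point ?T (- grad L (x l))) \<longlonglongrightarrow> 0"
    using proj_grad_eq_0[OF neg_grad_in_normal_cone] by simp
  moreover have "\<forall>\<^sub>F l in sequentially. closest_point ?T (- grad L (x l)) = proj_grad (Omega C) L (x l)"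
    using eventually_active_eq
  proof eventually_elim
    case (elim l)
    then have "tangent_cone (Omega C) (x l) = ?T"
      using tangent_cone_Omega[OF wf x_in_Omega, of l] tangent_cone_Omega[OF wf xs_in] by simp
    then show ?case unfolding proj_grad_def by simp
  qed
  ultimately have "(\<lambda>l. proj_grad (Omega C) L (x l)) \<longlonglongrightarrow> 0"
    by (rule Lim_transform_eventually)
  then show ?thesis by (rule tendsto_norm_zero)
qed

end

theorem theorem4p3:
  fixes C :: "('n::finite) block_constraints"
    and p :: trap_params
    and L :: "real ^ 'n \<Rightarrow> real"
    and B :: "real ^ 'n \<Rightarrow> real ^ 'n ^ 'n"
    and x0 xstar :: "real ^ 'n"
    and x :: "nat \<Rightarrow> real ^ 'n"
    and \<Delta> :: "nat \<Rightarrow> real"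
    and U :: "(real ^ 'n) set"
    and Bhat \<kappa> :: real
  assumes "wf_constraints C"
    and "\<And>k. k \<in> {1..num_blocks C} \<Longrightarrow> Omega_block C k \<noteq> {}"
    and "valid_params p"
    and "x0 \<in> Omega C"
    and "\<And>w. w \<in> Omega C \<Longrightarrow> transpose (B w) = B w"
    and "trap_sequence p C L B x0 x \<Delta>"
    and "\<And>l. \<not> critical_point (Omega C) L (x l)"
    and bounded_below: "bdd_below (L ` {w \<in> Omega C. L w \<le> L x0})"
    and C1: "open U" "Omega C \<subseteq> U" "\<And>w. w \<in> U \<Longrightarrow> L differentiable (at w)"
      "continuous_on U (grad L)"
    and uniform: "uniformly_continuous_on (Omega C) (grad L)"
    and B_bound: "Bhat > 0" "\<And>w. w \<in> Omega C \<Longrightarrow> onorm ((*v) (B w)) \<le> Bhat"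
    and limit_point: "\<exists>r. strict_mono r \<and> (x \<circ> r) \<longlonglongrightarrow> xstar"
    and nondeg: "nondegenerate (Omega C) L xstar"
    and hessian_exists: "grad L differentiable (at xstar)"
    and second_order: "\<kappa> > 0"
      "\<And>v. v \<in> orthogonal_comp (normal_cone (Omega C) xstar) \<Longrightarrow>
         v \<bullet> (hessian L xstar *v v) \<ge> \<kappa> * (norm v)\<^sup>2"
  shows "(\<lambda>l. norm (proj_grad (Omega C) L (x l))) \<longlonglongrightarrow> 0 \<and>
    (\<exists>l0. \<forall>l\<ge>l0. active C (x l) = active C xstar)"
proof -
  have "\<exists>z y. \<forall>l. cauchy_point p C L B (x l) (\<Delta> l) (z l) \<and>
      refinement p C L B (x l) (\<Delta> l) (z l) (y l) \<and>
      trap_update p L B (x l) (\<Delta> l) (y l) (x (Suc l)) (\<Delta> (Suc l))"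
    using assms(6) unfolding trap_sequence_def by metis
  then obtain z y where zy: "\<And>l. cauchy_point p C L B (x l) (\<Delta> l) (z l)"
    "\<And>l. refinement p C L B (x l) (\<Delta> l) (z l) (y l)"
    "\<And>l. trap_update p L B (x l) (\<Delta> l) (y l) (x (Suc l)) (\<Delta> (Suc l))"
    by blast
  have start: "x 0 = x0" "\<Delta> 0 = Delta0 p"
    using assms(6) unfolding trap_sequence_def by blast+
  interpret trap_run C xstar L p B x y z \<Delta> Bhat \<kappa>
  proof unfold_locales
    show "xstar \<in> Omega C" using nondeg unfolding nondegenerate_def by blast
    show "x 0 \<in> Omega C" using start assms(4) by simp
    show "0 < \<Delta> 0" using start assms(3) unfolding valid_params_def by simp
    show "L differentiable (at w)" if "w \<in> Omega C" for w using C1(2,3) that by blast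
  qed (fact assms zy)+
  show ?thesis
    using proj_grad_tendsto eventually_active_eq unfolding eventually_sequentially by blast
qed

end
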